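(* Let $\mathcal B$ be a braided $*$-bialgebra with an additive deformation $(\mu_t)_{t\in\mathbb R}$ with generator $L$, and let $\psi:\mathcal B\to\mathbb C$ be a hermitian ($\psi(b^* )=\overline{\psi(b)}$), $\beta$-invariant ($(\psi\otimes\mathrm{id})\circ\beta=\mathrm{id}\otimes\psi$) linear functional with $\psi(\mathbf 1)=0$. Then the following are equivalent: (i) for all $t\ge0$, $\varphi_t:=e_\star^{t\psi}$ is a state on $\mathcal B_t=(\mathcal B,\mu_t)$, i.e. $\varphi_t(\mathbf 1)=1$ and $\varphi_t(\mu_t(b^*\otimes b))\ge0$ for all $b\in\mathcal B$; (ii) $(\psi\circ\mu+L)(b^*\otimes b)\ge0$ for all $b\in\ker\delta$.
   Context: Braided vector space: $\beta\in\mathrm{Aut}(V\otimes V)$ satisfying the braid equation; $\beta_{1,0}=\beta_{0,1}=\mathrm{id}$, $\beta_{1,m+1}=(\mathrm{id}\otimes\beta_{1,m})(\beta\otimes\mathrm{id})$, $\beta_{n+1,m}=(\beta_{n,m}\otimes\mathrm{id})(\mathrm{id}\otimes\beta_{1,m})$; $f:V^{\otimes m}\to V^{\otimes n}$ is $\beta$-invariant if $(f\otimes\mathrm{id})\beta_{1,m}=\beta_{1,n}(\mathrm{id}\otimes f)$, $\beta^{-1}$-invariant if $(\mathrm{id}\otimes f)\beta_{m,1}=\beta_{n,1}(f\otimes\mathrm{id})$, $\beta$-compatible if both. A braided bialgebra $(\mathcal B,\Delta,\delta,\mu,\mathbf 1,\beta)$: unital algebra and counital coalgebra with $\mu,\mathbf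 1,\Delta,\delta$ $\beta$-compatible, $\Delta\circ\mu=(\mu\otimes\mu)\circ\Lambda$ where $\Lambda:=(\mathrm{id}\otimes\beta\otimes\mathrm{id})(\Delta\otimes\Delta)$, $\Delta(\mathbf 1)=\mathbf 1\otimes\mathbf 1$, $\delta\circ\mu=\delta\otimes\delta$, $\delta(\mathbf 1)=1$. Braided $*$-bialgebra: additionally an antilinear involution $*$ making $(\mathcal B,\mu,\mathbf 1)$ a $*$-algebra with $\Delta\circ*=\beta\circ( *\otimes* )\circ\tau\circ\Delta$, $\delta(b^* )=\overline{\delta(b)}$, and $\beta\circ( *\otimes* )\circ\tau=( *\otimes* )\circ\tau\circ\beta^{-1}$ ($\tau$ the flip). Convolution of functionals on $\mathcal B$: $\varphi\star\psi=(\varphi\otimes\psi)\circ\Delta$; on $\mathcal B\otimes\mathcal B$ w.r.t. $\Lambda$; $e_\star^{t\psi}=\sum_n t^n\psi^{\star n}/n!$ (pointwise convergent, $\psi^{\star0}=\delta$). Additive deformation: family $(\mu_t)_{t\in\mathbb R}$ of $\beta$-compatible maps $\mathcal B\otimes\mathcal B\to\mathcal B$ with $\mu_0=\mu$, each $(\mathcal B,\mu_t,\mathbf 1,\beta)$ a braided unital algebra, $\Delta\circ\mu_{t+s}=(\mu_t\otimes\mu_s)\circ\Lambda$, $\delta\circ\mu_t\to\delta\otimes\delta$ pointwise as $t\to0$. Its generator is the $\beta$-compatible functional $L=\lim_{t\to0}\frac1t(\delta\circ\mu_t-\delta\otimes\delta)$ on $\mathcal B\otimes\mathcal B$; one has $\mu_t=(\mu\otimes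 e_\star^{tL})\circ\Lambda$ and $L\star\mu=\mu\star L$. *)

theory Defs
  imports Complex_Main
begin

text \<open>
  Encoding.  The underlying complex vector space V of the braided bialgebra is
  represented by a Hamel basis indexed by the type 'i.  An element of the tensor
  power V^{\<otimes>n} is a finitely supported function on basis words of length n
  (type 'i list \<Rightarrow> complex).  A linear map V^{\<otimes>m} \<rightarrow> V^{\<otimes>n} is given by its
  values on basis words of length m (and extended linearly by app); an
  antilinear map is given the same way and extended antilinearly by aapp.
  A linear functional on V^{\<otimes>m} is given by its values on basis words.
\<close>

type_synonym 'i vec = "'i list \<Rightarrow> complex"
type_synonym 'i lmap = "'i list \<Rightarrow> 'i vec"
type_synonym 'i fnl = "'i list \<Rightarrow> complex"

definition supp :: "'i vec \<Rightarrow> 'i list set" where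
  "supp v = {k. v k \<noteq> 0}"

definition sing :: "'i list \<Rightarrow> 'i vec" where
  "sing k = (\<lambda>k'. if k' = k then 1 else 0)"

definition tens :: "nat \<Rightarrow> 'i vec \<Rightarrow> bool" where
  "tens n v \<longleftrightarrow> finite (supp v) \<and> (\<forall>k\<in>supp v. length k = n)"

definition lmap :: "nat \<Rightarrow> nat \<Rightarrow> 'i lmap \<Rightarrow> bool" where
  "lmap m n f \<longleftrightarrow> (\<forall>k. length k = m \<longrightarrow> tens n (f k))"

definition app :: "'i lmap \<Rightarrow> 'i vec \<Rightarrow> 'i vec" where
  "app f v = (\<lambda>k'. \<Sum>k\<in>supp v. v k * f k k')"

definition aapp :: "'i lmap \<Rightarrow> 'i vec \<Rightarrow> 'i vec" where
  "aapp f v = (\<lambda>k'. \<Sum>k\<in>supp v. cnj (v k) * f k k')"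

definition fapp :: "'i fnl \<Rightarrow> 'i vec \<Rightarrow> complex" where
  "fapp f v = (\<Sum>k\<in>supp v. v k * f k)"

definition comp :: "'i lmap \<Rightarrow> 'i lmap \<Rightarrow> 'i lmap" where
  "comp f g = (\<lambda>k. app f (g k))"

definition idm :: "'i lmap" where
  "idm = sing"

definition tvm :: "nat \<Rightarrow> 'i vec \<Rightarrow> 'i vec \<Rightarrow> 'i vec" where
  "tvm m v w = (\<lambda>k. v (take m k) * w (drop m k))"

definition tensm :: "nat \<Rightarrow> nat \<Rightarrow> 'i lmap \<Rightarrow> 'i lmap \<Rightarrow> 'i lmap" where
  "tensm m n f g = (\<lambda>k. tvm n (f (take m k)) (g (drop m k)))"

definition meq :: "nat \<Rightarrow> 'i lmap \<Rightarrow> 'i lmap \<Rightarrow> bool" where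
  "meq d f g \<longleftrightarrow> (\<forall>k. length k = d \<longrightarrow> f k = g k)"

definition tau :: "'i lmap" where
  "tau = (\<lambda>k. sing (rev k))"

text \<open>a functional V^{\<otimes>m} \<rightarrow> \<complex> seen as a map to V^{\<otimes>0} = \<complex>\<close>
definition fmap :: "'i fnl \<Rightarrow> 'i lmap" where
  "fmap f = (\<lambda>k. (\<lambda>k'. if k' = [] then f k else 0))"

definition mfun :: "'i lmap \<Rightarrow> 'i fnl" where
  "mfun f = (\<lambda>k. f k [])"

fun b1 :: "'i lmap \<Rightarrow> nat \<Rightarrow> 'i lmap" where
  "b1 \<beta> 0 = idm"
| "b1 \<beta> (Suc m) = comp (tensm 1 1 idm (b1 \<beta> m)) (tensm 2 2 \<beta> idm)"

fun bnm :: "'i lmap \<Rightarrow> nat \<Rightarrow> nat \<Rightarrow> 'i lmap" where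
  "bnm \<beta> 0 m = idm"
| "bnm \<beta> (Suc n) m =
     comp (tensm (n + m) (m + n) (bnm \<beta> n m) idm) (tensm n n idm (b1 \<beta> m))"

definition beta_inv :: "'i lmap \<Rightarrow> nat \<Rightarrow> nat \<Rightarrow> 'i lmap \<Rightarrow> bool" where
  "beta_inv \<beta> m n f \<longleftrightarrow>
     meq (1 + m) (comp (tensm m n f idm) (b1 \<beta> m)) (comp (b1 \<beta> n) (tensm 1 1 idm f))"

definition betainv_inv :: "'i lmap \<Rightarrow> nat \<Rightarrow> nat \<Rightarrow> 'i lmap \<Rightarrow> bool" where
  "betainv_inv \<beta> m n f \<longleftrightarrow>
     meq (m + 1) (comp (tensm 1 1 idm f) (bnm \<beta> m 1)) (comp (bnm \<beta> n 1) (tensm m n f idm))"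

definition beta_compat :: "'i lmap \<Rightarrow> nat \<Rightarrow> nat \<Rightarrow> 'i lmap \<Rightarrow> bool" where
  "beta_compat \<beta> m n f \<longleftrightarrow> beta_inv \<beta> m n f \<and> betainv_inv \<beta> m n f"

definition braided :: "'i lmap \<Rightarrow> 'i lmap \<Rightarrow> bool" where
  "braided \<beta> \<beta>i \<longleftrightarrow> lmap 2 2 \<beta> \<and> lmap 2 2 \<beta>i
     \<and> meq 2 (comp \<beta> \<beta>i) idm \<and> meq 2 (comp \<beta>i \<beta>) idm
     \<and> meq 3 (comp (tensm 2 2 \<beta> idm) (comp (tensm 1 1 idm \<beta>) (tensm 2 2 \<beta> idm)))
              (comp (tensm 1 1 idm \<beta>) (comp (tensm 2 2 \<beta> idm) (tensm 1 1 idm \<beta>)))"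

definition braided_unital_alg :: "'i lmap \<Rightarrow> 'i lmap \<Rightarrow> 'i lmap \<Rightarrow> bool" where
  "braided_unital_alg \<beta> \<mu> u \<longleftrightarrow> lmap 2 1 \<mu> \<and> lmap 0 1 u
     \<and> meq 3 (comp \<mu> (tensm 2 1 \<mu> idm)) (comp \<mu> (tensm 1 1 idm \<mu>))
     \<and> meq 1 (comp \<mu> (tensm 0 1 u idm)) idm
     \<and> meq 1 (comp \<mu> (tensm 1 1 idm u)) idm
     \<and> beta_compat \<beta> 2 1 \<mu> \<and> beta_compat \<beta> 0 1 u"

definition Lam :: "'i lmap \<Rightarrow> 'i lmap \<Rightarrow> 'i lmap" where
  "Lam \<beta> \<Delta> = comp (tensm 1 1 idm (tensm 2 2 \<beta> idm)) (tensm 1 2 \<Delta> \<Delta>)"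

definition braided_bialg ::
  "'i lmap \<Rightarrow> 'i lmap \<Rightarrow> 'i lmap \<Rightarrow> 'i lmap \<Rightarrow> 'i lmap \<Rightarrow> 'i lmap \<Rightarrow> bool" where
  "braided_bialg \<beta> \<beta>i \<mu> u \<Delta> \<delta> \<longleftrightarrow> braided \<beta> \<beta>i
     \<and> braided_unital_alg \<beta> \<mu> u
     \<and> lmap 1 2 \<Delta> \<and> lmap 1 0 \<delta>
     \<and> meq 1 (comp (tensm 1 2 \<Delta> idm) \<Delta>) (comp (tensm 1 1 idm \<Delta>) \<Delta>)
     \<and> meq 1 (comp (tensm 1 0 \<delta> idm) \<Delta>) idm
     \<and> meq 1 (comp (tensm 1 1 idm \<delta>) \<Delta>) idm
     \<and> beta_compat \<beta> 1 2 \<Delta> \<and> beta_compat \<beta> 1 0 \<delta>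
     \<and> meq 2 (comp \<Delta> \<mu>) (comp (tensm 2 1 \<mu> \<mu>) (Lam \<beta> \<Delta>))
     \<and> meq 0 (comp \<Delta> u) (tensm 0 1 u u)
     \<and> meq 2 (comp \<delta> \<mu>) (tensm 1 0 \<delta> \<delta>)
     \<and> meq 0 (comp \<delta> u) idm"

text \<open>braided *-bialgebra; the antilinear involution * is given by its values
  s on basis vectors and extended antilinearly (aapp)\<close>
definition braided_star_bialg ::
  "'i lmap \<Rightarrow> 'i lmap \<Rightarrow> 'i lmap \<Rightarrow> 'i lmap \<Rightarrow> 'i lmap \<Rightarrow> 'i lmap \<Rightarrow> 'i lmap \<Rightarrow> bool" where
  "braided_star_bialg \<beta> \<beta>i \<mu> u \<Delta> \<delta> s \<longleftrightarrow> braided_bialg \<beta> \<beta>i \<mu> u \<Delta> \<delta>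
     \<and> lmap 1 1 s
     \<and> (\<forall>k. length k = 1 \<longrightarrow> aapp s (s k) = sing k)
     \<and> (\<forall>k. length k = 2 \<longrightarrow> aapp s (\<mu> k) = app \<mu> (aapp (tensm 1 1 s s) (tau k)))
     \<and> aapp s (u []) = u []
     \<and> (\<forall>k. length k = 1 \<longrightarrow>
           app \<Delta> (s k) = app \<beta> (aapp (tensm 1 1 s s) (app tau (\<Delta> k))))
     \<and> (\<forall>k. length k = 1 \<longrightarrow> app \<delta> (s k) [] = cnj (\<delta> k []))
     \<and> (\<forall>k. length k = 2 \<longrightarrow>
           app \<beta> (aapp (tensm 1 1 s s) (tau k)) = aapp (tensm 1 1 s s) (app tau (\<beta>i k)))"

definition additive_deformation ::
  "'i lmap \<Rightarrow> 'i lmap \<Rightarrow> 'i lmap \<Rightarrow> 'i lmap \<Rightarrow> 'i lmap \<Rightarrow> (real \<Rightarrow> 'i lmap) \<Rightarrow> bool" where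
  "additive_deformation \<beta> \<mu> u \<Delta> \<delta> \<mu>t \<longleftrightarrow>
     \<mu>t 0 = \<mu>
     \<and> (\<forall>t. braided_unital_alg \<beta> (\<mu>t t) u)
     \<and> (\<forall>t s. meq 2 (comp \<Delta> (\<mu>t (t + s))) (comp (tensm 2 1 (\<mu>t t) (\<mu>t s)) (Lam \<beta> \<Delta>)))
     \<and> (\<forall>k. length k = 2 \<longrightarrow>
           ((\<lambda>t. app \<delta> (\<mu>t t k) []) \<longlongrightarrow> tensm 1 0 \<delta> \<delta> k []) (at 0))"

definition is_generator :: "'i lmap \<Rightarrow> (real \<Rightarrow> 'i lmap) \<Rightarrow> 'i fnl \<Rightarrow> bool" where
  "is_generator \<delta> \<mu>t L \<longleftrightarrow> (\<forall>k. length k = 2 \<longrightarrow>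
     ((\<lambda>t. (app \<delta> (\<mu>t t k) [] - tensm 1 0 \<delta> \<delta> k []) / complex_of_real t) \<longlongrightarrow> L k) (at 0))"

definition conv :: "'i lmap \<Rightarrow> 'i fnl \<Rightarrow> 'i fnl \<Rightarrow> 'i fnl" where
  "conv \<Delta> f g = (\<lambda>k. fapp (\<lambda>k'. f (take 1 k') * g (drop 1 k')) (\<Delta> k))"

fun cpow :: "'i lmap \<Rightarrow> 'i lmap \<Rightarrow> 'i fnl \<Rightarrow> nat \<Rightarrow> 'i fnl" where
  "cpow \<Delta> \<delta> \<psi> 0 = mfun \<delta>"
| "cpow \<Delta> \<delta> \<psi> (Suc n) = conv \<Delta> \<psi> (cpow \<Delta> \<delta> \<psi> n)"

definition cexp :: "'i lmap \<Rightarrow> 'i lmap \<Rightarrow> real \<Rightarrow> 'i fnl \<Rightarrow> 'i fnl" where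
  "cexp \<Delta> \<delta> t \<psi> = (\<lambda>k. \<Sum>n. complex_of_real t ^ n / of_nat (fact n) * cpow \<Delta> \<delta> \<psi> n k)"

definition cnonneg :: "complex \<Rightarrow> bool" where
  "cnonneg z \<longleftrightarrow> Im z = 0 \<and> 0 \<le> Re z"

end

theory Submission
  imports Defs
begin

text \<open>
  Put \<open>F\<^sub>t(b, c) = \<phi>\<^sub>t(\<mu>\<^sub>t(b* \<otimes> c))\<close>. Since \<open>\<phi>\<^sub>t \<circ> \<mu>\<^sub>t\<close> is \<open>\<beta>\<close>-invariant, the braiding in
  \<open>\<Lambda>\<close> and the braiding in \<open>\<Delta> \<circ> *\<close> cancel, so \<open>(F\<^sub>t)\<close> is a convolution semigroup of sesquilinear
  forms for the unbraided coalgebra \<open>conj(B) \<otimes> B\<close>, with derivative \<open>K(b, c) = (\<psi> \<circ> \<mu> + L)(b* \<otimes> c)\<close>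
  at \<open>0\<close>. Positivity of all \<open>F\<^sub>t\<close> gives positivity of \<open>K\<close> on the kernel of \<open>\<delta>\<close> by differentiation.
  Conversely, writing \<open>b = b\<^sub>0 + \<delta>(b) 1\<close>, the form
  \<open>G\<^sub>r(b, b) = |\<delta>(b) + r \<psi>(b)|\<^sup>2 + r K(b\<^sub>0, b\<^sub>0)\<close> is positive and agrees with \<open>F\<^sub>r\<close> to first order; its
  convolution powers are positive by the Schur product theorem, and the \<open>n\<close>-th power of \<open>G\<^sub>t\<^sub>/\<^sub>n\<close>
  converges to \<open>F\<^sub>t\<close> because one element of a coalgebra only sees finitely many dimensions.
\<close>

subsection \<open>Convolution semigroups on a coalgebra\<close>

text \<open>On basis elements the comultiplication is
  \<open>x \<mapsto> \<Sum>w\<in>T x. c x w (l w \<otimes> r w)\<close>. Its axioms are stated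
  dually: functionals form an associative unital convolution algebra. This covers both B and the
  coalgebra whose functionals are sesquilinear forms.\<close>

locale coalgebra =
  fixes T :: "'j \<Rightarrow> 'w set" and c :: "'j \<Rightarrow> 'w \<Rightarrow> complex"
    and l r :: "'w \<Rightarrow> 'j" and cv :: "('j \<Rightarrow> complex) \<Rightarrow> ('j \<Rightarrow> complex) \<Rightarrow> 'j \<Rightarrow> complex"
    and \<epsilon> :: "'j \<Rightarrow> complex"
  assumes fin: "finite (T x)"
    and cv_eq: "cv f g x = (\<Sum>w\<in>T x. c x w * (f (l w) * g (r w)))"
    and assoc: "cv (cv f g) h x = cv f (cv g h) x"
    and unit_l: "cv \<epsilon> f x = f x"
    and unit_r: "cv f \<epsilon> x = f x"
begin

definition e :: "'j \<Rightarrow> 'j \<Rightarrow> complex" where "e y z = (if z = y then 1 else 0)"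

definition legs :: "'j \<Rightarrow> 'j set" where "legs x = l ` T x"

text \<open>The right legs \<open>(e y \<otimes> id) (\<Delta> x)\<close> with \<open>y \<in> legs x\<close> span a finite-dimensional left coideal
  containing \<open>x\<close>. Convolution with \<open>f\<close> acts on it by the matrix with entries \<open>cv (e y) f i\<close>, so
  \<open>leg_norm x\<close> and \<open>leg_opnorm x\<close> are a seminorm and a matrix norm bounding this action.\<close>

definition leg_norm :: "'j \<Rightarrow> ('j \<Rightarrow> complex) \<Rightarrow> real" where
  "leg_norm x f = (\<Sum>y\<in>legs x. norm (cv (e y) f x))"

definition leg_opnorm :: "'j \<Rightarrow> ('j \<Rightarrow> complex) \<Rightarrow> real" where
  "leg_opnorm x f = (\<Sum>y\<in>legs x. \<Sum>i\<in>legs x. norm (cv (e y) f i))"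

lemma finite_legs [simp]: "finite (legs x)"
  by (simp add: legs_def fin)

section \<open>Bilinearity of convolution and norm estimates\<close>

lemma cv_add_r: "cv f (\<lambda>z. g z + h z) x = cv f g x + cv f h x"
  by (simp add: cv_eq algebra_simps sum.distrib)

lemma cv_add_l: "cv (\<lambda>z. f z + g z) h x = cv f h x + cv g h x"
  by (simp add: cv_eq algebra_simps sum.distrib)

lemma cv_diff_r: "cv f (\<lambda>z. g z - h z) x = cv f g x - cv f h x"
  by (simp add: cv_eq algebra_simps sum_subtractf)

lemma cv_diff_l: "cv (\<lambda>z. f z - g z) h x = cv f h x - cv g h x"
  by (simp add: cv_eq algebra_simps sum_subtractf)

lemma cv_scale_r: "cv f (\<lambda>z. a * g z) x = a * cv f g x"
  by (simp add: cv_eq algebra_simps sum_distrib_left)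

lemma cv_scale_l: "cv (\<lambda>z. a * f z) g x = a * cv f g x"
  by (simp add: cv_eq algebra_simps sum_distrib_left)

text \<open>All left legs of \<open>x\<close> lie in the finite set \<open>legs x\<close>, so
  \<open>f\<close> enters only through its values there; the \<open>e y\<close> are coordinate
  functionals.\<close>

lemma cv_expand: "cv f g x = (\<Sum>y\<in>legs x. f y * cv (e y) g x)"
proof -
  have "cv f g x = (\<Sum>w\<in>T x. \<Sum>y\<in>legs x. f y * (c x w * (e y (l w) * g (r w))))"
    unfolding cv_eq
  proof (rule sum.cong[OF refl])
    fix w assume w: "w \<in> T x"
    have "(\<Sum>y\<in>legs x. f y * (c x w * (e y (l w) * g (r w))))
        = (\<Sum>y\<in>legs x. if y = l w then f y * c x w * g (r w) else 0)"
      by (rule sum.cong) (auto simp: e_def)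
    also have "\<dots> = f (l w) * c x w * g (r w)"
      using w by (simp add: legs_def fin)
    finally show "c x w * (f (l w) * g (r w)) = (\<Sum>y\<in>legs x. f y * (c x w * (e y (l w) * g (r w))))"
      by simp
  qed
  also have "\<dots> = (\<Sum>y\<in>legs x. f y * cv (e y) g x)"
    unfolding cv_eq by (subst sum.swap) (simp add: sum_distrib_left)
  finally show ?thesis .
qed

lemma leg_norm_nonneg: "leg_norm x f \<ge> 0"
  by (simp add: leg_norm_def sum_nonneg)

lemma leg_opnorm_nonneg: "leg_opnorm x f \<ge> 0"
  by (simp add: leg_opnorm_def sum_nonneg)

lemma leg_norm_add: "leg_norm x (\<lambda>z. f z + g z) \<le> leg_norm x f + leg_norm x g"
  unfolding leg_norm_def sum.distrib[symmetric] cv_add_r by (intro sum_mono norm_triangle_ineq)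

lemma leg_norm_scale: "leg_norm x (\<lambda>z. a * f z) = norm a * leg_norm x f"
  unfolding leg_norm_def cv_scale_r by (simp add: norm_mult sum_distrib_left)

text \<open>By associativity \<open>e y\<close> can be convolved with \<open>f\<close> first;
  \<open>cv_expand\<close> then turns the remaining convolution with \<open>g\<close> into a matrix
  acting on a vector.\<close>

lemma leg_norm_cv: "leg_norm x (cv f g) \<le> leg_opnorm x f * leg_norm x g"
proof -
  have "leg_norm x (cv f g) = (\<Sum>y\<in>legs x. norm (\<Sum>i\<in>legs x. cv (e y) f i * cv (e i) g x))"
    unfolding leg_norm_def by (simp add: assoc[symmetric] cv_expand[of "cv _ _"])
  also have "\<dots> \<le> (\<Sum>y\<in>legs x. \<Sum>i\<in>legs x. norm (cv (e y) f i) * leg_norm x g)"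
  proof (intro sum_mono order_trans[OF norm_sum])
    fix y i assume "i \<in> legs x"
    then have "norm (cv (e i) g x) \<le> leg_norm x g"
      unfolding leg_norm_def by (intro member_le_sum) auto
    then show "norm (cv (e y) f i * cv (e i) g x) \<le> norm (cv (e y) f i) * leg_norm x g"
      by (simp add: norm_mult mult_left_mono)
  qed
  also have "\<dots> = leg_opnorm x f * leg_norm x g"
    by (simp add: leg_opnorm_def sum_distrib_right)
  finally show ?thesis .
qed

text \<open>Expands \<open>\<epsilon> \<star> f = f\<close> over the left legs. Smallness in
  \<open>leg_norm x\<close> thus gives smallness at the point \<open>x\<close>.\<close>

lemma norm_le_leg_norm: "norm (f x) \<le> (\<Sum>y\<in>legs x. norm (\<epsilon> y)) * leg_norm x f"
proof -
  have "norm (f x) = norm (\<Sum>y\<in>legs x. \<epsilon> y * cv (e y) f x)"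
    by (simp add: cv_expand[symmetric] unit_l)
  also have "\<dots> \<le> (\<Sum>y\<in>legs x. norm (\<epsilon> y) * leg_norm x f)"
  proof (intro order_trans[OF norm_sum] sum_mono)
    fix y assume "y \<in> legs x"
    then have "norm (cv (e y) f x) \<le> leg_norm x f"
      unfolding leg_norm_def by (intro member_le_sum) auto
    then show "norm (\<epsilon> y * cv (e y) f x) \<le> norm (\<epsilon> y) * leg_norm x f"
      by (simp add: norm_mult mult_left_mono)
  qed
  finally show ?thesis by (simp add: sum_distrib_right)
qed

lemma tendsto_cv_r:
  assumes "\<And>z. ((\<lambda>s. f s z) \<longlongrightarrow> k z) A"
  shows "((\<lambda>s. cv g (f s) x) \<longlongrightarrow> cv g k x) A"
  unfolding cv_eq by (intro tendsto_intros assms)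

lemma tendsto_leg_opnorm:
  assumes "\<And>z. ((\<lambda>s. f s z) \<longlongrightarrow> k z) A"
  shows "((\<lambda>s. leg_opnorm x (f s)) \<longlongrightarrow> leg_opnorm x k) A"
  unfolding leg_opnorm_def by (intro tendsto_intros tendsto_cv_r assms)

section \<open>Convolution powers and exponentials\<close>

primrec pow :: "('j \<Rightarrow> complex) \<Rightarrow> nat \<Rightarrow> 'j \<Rightarrow> complex" where
  "pow f 0 = \<epsilon>"
| "pow f (Suc n) = cv f (pow f n)"

lemma pow_add: "pow f (m + n) x = cv (pow f m) (pow f n) x"
proof (induction m arbitrary: x)
  case (Suc m)
  then have "pow f (m + n) = cv (pow f m) (pow f n)" by auto
  then show ?case by (simp add: assoc)
qed (simp add: unit_l)

lemma leg_norm_pow: "leg_norm x (pow f n) \<le> leg_opnorm x f ^ n * leg_norm x \<epsilon>"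
proof (induction n)
  case (Suc n)
  have "leg_norm x (pow f (Suc n)) \<le> leg_opnorm x f * leg_norm x (pow f n)" by (simp add: leg_norm_cv)
  also have "\<dots> \<le> leg_opnorm x f * (leg_opnorm x f ^ n * leg_norm x \<epsilon>)"
    by (intro mult_left_mono Suc leg_opnorm_nonneg)
  finally show ?case by (simp add: mult_ac)
qed simp

text \<open>At a fixed point the powers grow at most geometrically by \<open>leg_norm_pow\<close>,
  so an exponential series dominates.\<close>

lemma summable_pow: "summable (\<lambda>n. norm (a ^ n / of_nat (fact n) * pow f n x))" for a :: complex
proof -
  define C where "C = (\<Sum>y\<in>legs x. norm (\<epsilon> y))"
  have C: "C \<ge> 0" by (simp add: C_def sum_nonneg)
  have "summable (\<lambda>n. C * leg_norm x \<epsilon> * (inverse (fact n) * (norm a * leg_opnorm x f) ^ n))"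
    by (intro summable_mult summable_exp)
  then show ?thesis
  proof (rule summable_comparison_test[rotated], intro exI allI impI)
    fix n :: nat
    have "norm (pow f n x) \<le> C * (leg_opnorm x f ^ n * leg_norm x \<epsilon>)"
      using norm_le_leg_norm[of "pow f n" x] mult_left_mono[OF leg_norm_pow[of x f n] C]
      by (simp add: C_def)
    then have "norm a ^ n / fact n * norm (pow f n x) \<le> norm a ^ n / fact n * (C * (leg_opnorm x f ^ n * leg_norm x \<epsilon>))"
      by (intro mult_left_mono) auto
    then show "norm (norm (a ^ n / of_nat (fact n) * pow f n x))
        \<le> C * leg_norm x \<epsilon> * (inverse (fact n) * (norm a * leg_opnorm x f) ^ n)"
      by (simp add: norm_mult norm_divide norm_power power_mult_distrib field_simps)
  qed
qed

definition cvexp :: "('j \<Rightarrow> complex) \<Rightarrow> complex \<Rightarrow> 'j \<Rightarrow> complex" where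
  "cvexp f a x = (\<Sum>n. a ^ n / of_nat (fact n) * pow f n x)"

lemma cvexp_sums: "(\<lambda>n. a ^ n / of_nat (fact n) * pow f n x) sums cvexp f a x"
  unfolding cvexp_def by (intro summable_sums summable_norm_cancel[OF summable_pow])

lemma cvexp_0: "cvexp f 0 x = \<epsilon> x"
proof -
  have "(\<lambda>n. 0 ^ n / of_nat (fact n) * pow f n x) sums \<epsilon> x"
    using powser_sums_zero[of "\<lambda>n. pow f n x / of_nat (fact n)"] by (simp add: mult_ac)
  then show ?thesis using cvexp_sums[of 0 f x] sums_unique2 by blast
qed

lemma binomial_exp_coeff:
  fixes a b :: complex
  shows "(\<Sum>i\<le>k. (a ^ i / of_nat (fact i)) * (b ^ (k - i) / of_nat (fact (k - i))))
     = (a + b) ^ k / of_nat (fact k)"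
  using exp_series_add_commuting[of a b k]
  by (simp add: scaleR_conv_of_real field_simps of_real_inverse)

text \<open>Each of the finitely many terms of the coproduct of \<open>x\<close> contributes a
  Cauchy product of two series; \<open>pow_add\<close> then leaves a binomial sum in every
  degree.\<close>

lemma cvexp_add: "cvexp f (a + b) x = cv (cvexp f a) (cvexp f b) x"
proof -
  let ?p = "\<lambda>a x n. a ^ n / of_nat (fact n) * pow f n x"
  have 1: "(\<lambda>k. \<Sum>i\<le>k. ?p a y i * ?p b z (k - i)) sums (cvexp f a y * cvexp f b z)" for y z
    unfolding cvexp_def using summable_pow[of a f y] summable_pow[of b f z]
    by (intro Cauchy_product_sums)
  have "(\<lambda>k. \<Sum>w\<in>T x. c x w * (\<Sum>i\<le>k. ?p a (l w) i * ?p b (r w) (k - i)))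
      sums cv (cvexp f a) (cvexp f b) x"
    unfolding cv_eq[of "cvexp f a" "cvexp f b"] by (intro sums_sum sums_mult 1)
  moreover have "(\<Sum>w\<in>T x. c x w * (\<Sum>i\<le>k. ?p a (l w) i * ?p b (r w) (k - i))) = ?p (a + b) x k" for k
  proof -
    have "(\<Sum>w\<in>T x. c x w * (\<Sum>i\<le>k. ?p a (l w) i * ?p b (r w) (k - i)))
       = (\<Sum>i\<le>k. (a ^ i / of_nat (fact i)) * (b ^ (k - i) / of_nat (fact (k - i)))
            * cv (pow f i) (pow f (k - i)) x)"
      unfolding cv_eq[of "pow f _" "pow f _"] sum_distrib_left by (subst sum.swap) (simp add: mult_ac)
    also have "\<dots> = (\<Sum>i\<le>k. (a ^ i / of_nat (fact i)) * (b ^ (k - i) / of_nat (fact (k - i)))) * pow f k x"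
      unfolding sum_distrib_right by (intro sum.cong) (simp_all add: pow_add[symmetric])
    finally show ?thesis by (simp only: binomial_exp_coeff)
  qed
  ultimately show ?thesis using cvexp_sums[of "a + b" f x] sums_unique2 by simp
qed

text \<open>At a fixed point the exponential is an everywhere convergent power series in the scalar,
  with linear coefficient \<open>cv f \<epsilon> = f\<close>.\<close>

lemma cvexp_deriv: "((\<lambda>a. cvexp f a x) has_field_derivative f x) (at 0)"
proof -
  let ?q = "\<lambda>n. pow f n x / of_nat (fact n)"
  have eq: "cvexp f a x = (\<Sum>n. ?q n * a ^ n)" for a
    by (simp add: cvexp_def mult_ac)
  have "summable (\<lambda>n. ?q n * a ^ n)" for a
    using sums_summable[OF cvexp_sums[of a f x]] by (simp add: mult_ac)
  then have "((\<lambda>a. cvexp f a x) has_field_derivative (\<Sum>n. diffs ?q n * 0 ^ n)) (at 0)"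
    unfolding eq by (intro termdiffs_strong_converges_everywhere)
  moreover have "(\<Sum>n. diffs ?q n * 0 ^ n) = f x"
    by (simp add: diffs_def unit_r)
  ultimately show ?thesis by simp
qed

text \<open>Telescoping: \<open>F t\<close> and the power of \<open>G (t / n)\<close> differ by \<open>n\<close> errors of size \<open>o(t / n)\<close>, each
  amplified by at most \<open>(1 + t C / n)\<^sup>n \<le> exp (t C)\<close>.\<close>

lemma product_formula:
  fixes F G :: "real \<Rightarrow> 'j \<Rightarrow> complex"
  assumes F0: "F 0 = \<epsilon>"
    and F_add: "\<And>a b x. F (a + b) x = cv (F a) (F b) x"
    and F': "\<And>x. ((\<lambda>s. (F s x - \<epsilon> x) / of_real s) \<longlongrightarrow> K x) (at_right 0)"
    and G': "\<And>x. ((\<lambda>s. (G s x - \<epsilon> x) / of_real s) \<longlongrightarrow> K x) (at_right 0)"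
    and t: "t > 0"
  shows "(\<lambda>n. pow (G (t / real n)) n x) \<longlonglongrightarrow> F t x"
proof -
  define A where "A = (\<lambda>s x. (F s x - \<epsilon> x) / of_real s)"
  define B where "B = (\<lambda>s x. (G s x - \<epsilon> x) / of_real s)"
  define \<eta> where "\<eta> = (\<lambda>s. leg_opnorm x (\<lambda>z. A s z - B s z))"
  \<comment> \<open>The summand 1 leaves room above the limit, so that both difference quotients
    eventually have matrix norm below \<open>C\<close>.\<close>
  define C where "C = leg_opnorm x K + 1"
  have C: "C \<ge> 0" by (simp add: C_def leg_opnorm_nonneg add_nonneg_nonneg)
  have evA: "eventually (\<lambda>s. leg_opnorm x (A s) < C) (at_right 0)"
    by (rule order_tendstoD(2)[OF tendsto_leg_opnorm]) (use F' in \<open>auto simp: A_def C_def\<close>)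
  have evB: "eventually (\<lambda>s. leg_opnorm x (B s) < C) (at_right 0)"
    by (rule order_tendstoD(2)[OF tendsto_leg_opnorm]) (use G' in \<open>auto simp: B_def C_def\<close>)
  have "(\<eta> \<longlongrightarrow> leg_opnorm x (\<lambda>z. K z - K z)) (at_right 0)"
    unfolding \<eta>_def by (intro tendsto_leg_opnorm tendsto_diff) (use F' G' in \<open>auto simp: A_def B_def\<close>)
  then have eta0: "(\<eta> \<longlongrightarrow> 0) (at_right 0)"
    by (simp add: leg_opnorm_def cv_eq)
  have step: "leg_norm x (\<lambda>z. F (real k * s) z - pow (G s) k z) \<le> real k * s * \<eta> s * (1 + s * C) ^ k * leg_norm x \<epsilon>"
    if s: "s > 0" and MA: "leg_opnorm x (A s) < C" and MB: "leg_opnorm x (B s) < C" for s k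
  proof -
    have FA: "F s = (\<lambda>z. \<epsilon> z + of_real s * A s z)" and GB: "G s = (\<lambda>z. \<epsilon> z + of_real s * B s z)"
      using s by (auto simp: A_def B_def)
    have grow: "leg_norm x (\<lambda>z. cv (\<lambda>z. \<epsilon> z + of_real s * H z) g z) \<le> (1 + s * C) * leg_norm x g"
      if "leg_opnorm x H < C" for H g
    proof -
      have "leg_norm x (\<lambda>z. cv (\<lambda>z. \<epsilon> z + of_real s * H z) g z) \<le> leg_norm x g + s * leg_norm x (cv H g)"
        using leg_norm_add[of x g "\<lambda>z. of_real s * cv H g z"] s
        by (simp add: cv_add_l cv_scale_l unit_l leg_norm_scale)
      also have "s * leg_norm x (cv H g) \<le> s * (C * leg_norm x g)"
        using that s leg_norm_nonneg[of x g]
        by (intro mult_left_mono order_trans[OF leg_norm_cv] mult_right_mono) auto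
      finally show ?thesis by (simp add: algebra_simps)
    qed
    have powB: "leg_norm x (pow (G s) k) \<le> (1 + s * C) ^ k * leg_norm x \<epsilon>" for k
    proof (induction k)
      case (Suc k)
      have "leg_norm x (pow (G s) (Suc k)) \<le> (1 + s * C) * leg_norm x (pow (G s) k)"
        using grow[OF MB, of "pow (G s) k"] GB by simp
      also have "\<dots> \<le> (1 + s * C) * ((1 + s * C) ^ k * leg_norm x \<epsilon>)"
        using s C by (intro mult_left_mono Suc) auto
      finally show ?case by (simp add: mult_ac)
    qed simp
    show ?thesis
    proof (induction k)
      case 0
      show ?case using leg_norm_scale[of x 0 \<epsilon>] by (simp add: F0)
    next
      case (Suc k)
      let ?d = "\<lambda>z. F (real k * s) z - pow (G s) k z"
      \<comment> \<open>Insert \<open>cv (F s) (pow (G s) k)\<close>: the first term propagates the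
        old error, the second is the new one, as \<open>F s - G s\<close> is \<open>s\<close> times
        \<open>A s - B s\<close>.\<close>
      have d: "(\<lambda>z. F (real (Suc k) * s) z - pow (G s) (Suc k) z)
          = (\<lambda>z. cv (F s) ?d z + of_real s * cv (\<lambda>z. A s z - B s z) (pow (G s) k) z)"
      proof
        fix z
        have "F (real (Suc k) * s) z = cv (F s) (F (real k * s)) z"
          using F_add[of s "real k * s" z] by (simp add: algebra_simps)
        moreover have "pow (G s) (Suc k) z = pow (G s) k z + of_real s * cv (B s) (pow (G s) k) z"
          by (simp add: cv_add_l cv_scale_l unit_l GB)
        moreover have "cv (F s) (pow (G s) k) z = pow (G s) k z + of_real s * cv (A s) (pow (G s) k) z"
          by (simp add: FA cv_add_l cv_scale_l unit_l)
        ultimately show "F (real (Suc k) * s) z - pow (G s) (Suc k) z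
            = cv (F s) ?d z + of_real s * cv (\<lambda>z. A s z - B s z) (pow (G s) k) z"
          by (simp add: cv_diff_l cv_diff_r algebra_simps)
      qed
      have q: "1 \<le> 1 + s * C" using s C by simp
      have "leg_norm x (\<lambda>z. F (real (Suc k) * s) z - pow (G s) (Suc k) z)
          \<le> leg_norm x (cv (F s) ?d) + s * leg_norm x (cv (\<lambda>z. A s z - B s z) (pow (G s) k))"
        unfolding d using leg_norm_add[of x "cv (F s) ?d" "\<lambda>z. of_real s * cv (\<lambda>z. A s z - B s z) (pow (G s) k) z"] s
        by (simp add: leg_norm_scale)
      also have "leg_norm x (cv (F s) ?d) \<le> (1 + s * C) * (real k * s * \<eta> s * (1 + s * C) ^ k * leg_norm x \<epsilon>)"
        using q grow[OF MA, of ?d] FA by (intro order_trans[OF _ mult_left_mono[OF Suc]]) auto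
      also have "leg_norm x (cv (\<lambda>z. A s z - B s z) (pow (G s) k)) \<le> \<eta> s * ((1 + s * C) ^ k * leg_norm x \<epsilon>)"
        unfolding \<eta>_def by (intro order_trans[OF leg_norm_cv] mult_left_mono powB leg_opnorm_nonneg)
      \<comment> \<open>Raising the exponent gives the new error the same factor as the propagated
        one, so the two add up to \<open>Suc k\<close> errors.\<close>
      also have "\<dots> \<le> \<eta> s * ((1 + s * C) ^ Suc k * leg_norm x \<epsilon>)"
        using q leg_opnorm_nonneg leg_norm_nonneg unfolding \<eta>_def
        by (intro mult_left_mono mult_right_mono power_increasing) auto
      finally show ?case using s by (simp add: algebra_simps)
    qed
  qed
  define E where "E = (\<Sum>y\<in>legs x. norm (\<epsilon> y))"
  have E: "E \<ge> 0" by (simp add: E_def sum_nonneg)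
  have lim0: "filterlim (\<lambda>n. t / real n) (at_right 0) sequentially"
  proof -
    have "(\<lambda>n. t / real n) \<longlonglongrightarrow> 0" by (rule lim_const_over_n)
    moreover have "eventually (\<lambda>n. t / real n \<in> {0<..}) sequentially"
      using eventually_gt_at_top[of 0] by eventually_elim (use t in auto)
    ultimately show ?thesis by (simp add: filterlim_at eventually_conj_iff) (auto elim: eventually_mono)
  qed
  have bound: "eventually (\<lambda>n. norm (pow (G (t / real n)) n x - F t x) \<le> E * (t * \<eta> (t / real n) * exp (t * C) * leg_norm x \<epsilon>)) sequentially"
    using eventually_compose_filterlim[OF evA lim0] eventually_compose_filterlim[OF evB lim0]
      eventually_gt_at_top[of 0]
  proof eventually_elim
    case (elim n)
    define s where "s = t / real n"
    have s: "s > 0" and ns: "real n * s = t" using t elim by (auto simp: s_def)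
    have "(1 + s * C) ^ n \<le> exp (s * C) ^ n"
      using s C by (intro power_mono) (auto simp: add_nonneg_nonneg)
    also have "\<dots> = exp (t * C)" by (simp add: exp_of_nat_mult[symmetric] ns[symmetric] mult_ac)
    finally have le: "(1 + s * C) ^ n \<le> exp (t * C)" .
    have "norm (F t x - pow (G s) n x) \<le> E * leg_norm x (\<lambda>z. F (real n * s) z - pow (G s) n z)"
      unfolding E_def ns by (rule norm_le_leg_norm)
    also have "\<dots> \<le> E * (real n * s * \<eta> s * (1 + s * C) ^ n * leg_norm x \<epsilon>)"
      using elim s by (intro mult_left_mono step E) (auto simp: s_def)
    also have "\<dots> \<le> E * (t * \<eta> s * exp (t * C) * leg_norm x \<epsilon>)"
      unfolding ns using E le t by (intro mult_left_mono mult_right_mono mult_nonneg_nonneg)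
        (auto simp: \<eta>_def leg_opnorm_nonneg leg_norm_nonneg)
    finally show ?case by (simp add: s_def norm_minus_commute)
  qed
  have "(\<lambda>n. E * (t * \<eta> (t / real n) * exp (t * C) * leg_norm x \<epsilon>)) \<longlonglongrightarrow> E * (t * 0 * exp (t * C) * leg_norm x \<epsilon>)"
    by (intro tendsto_intros filterlim_compose[OF eta0 lim0])
  then have "(\<lambda>n. E * (t * \<eta> (t / real n) * exp (t * C) * leg_norm x \<epsilon>)) \<longlonglongrightarrow> 0" by simp
  then have "(\<lambda>n. pow (G (t / real n)) n x - F t x) \<longlonglongrightarrow> 0"
    by (rule tendsto_0_le[where K = 1])
      (use bound in \<open>auto elim!: eventually_mono intro: order_trans[OF _ abs_ge_self]\<close>)
  then show ?thesis by (rule LIM_zero_cancel)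
qed

end

subsection \<open>Positive semidefinite forms\<close>

lemma cnonneg_add: "cnonneg a \<Longrightarrow> cnonneg b \<Longrightarrow> cnonneg (a + b)"
  by (simp add: cnonneg_def)

lemma cnonneg_cnj_mult: "cnonneg (cnj a * a)"
  by (simp add: cnonneg_def)

lemma closed_cnonneg: "closed {z. cnonneg z}"
proof -
  have "closed {z. Im z = 0 \<and> 0 \<le> Re z}"
    by (intro closed_Collect_conj closed_Collect_eq closed_Collect_le continuous_intros)
  then show ?thesis by (simp add: cnonneg_def)
qed

lemma cnonneg_limit:
  assumes "(f \<longlongrightarrow> z) A" "A \<noteq> bot" "eventually (\<lambda>n. cnonneg (f n)) A"
  shows "cnonneg z"
  using Lim_in_closed_set[OF closed_cnonneg _ assms(2,1)] assms(3) by simp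

text \<open>Forms take a pair as argument because they serve as functionals on a coalgebra whose
  basis consists of pairs.\<close>

definition psd :: "('a \<times> 'a \<Rightarrow> complex) \<Rightarrow> bool" where
  "psd A \<longleftrightarrow> (\<forall>S v. finite S \<longrightarrow> cnonneg (\<Sum>x\<in>S. \<Sum>y\<in>S. cnj (v x) * v y * A (x, y)))"

text \<open>The points \<open>q i\<close> may repeat, as legs of different coproduct terms do;
  adding up the coefficients over each fibre of \<open>q\<close> gives an instance of
  \<open>psd\<close>.\<close>

lemma psd_pullback:
  assumes "psd A" "finite I"
  shows "cnonneg (\<Sum>i\<in>I. \<Sum>j\<in>I. cnj (v i) * v j * A (q i, q j))"
proof -
  define w where "w x = (\<Sum>i\<in>{i\<in>I. q i = x}. v i)" for x
  have group: "(\<Sum>i\<in>I. g i) = (\<Sum>x\<in>q ` I. \<Sum>i\<in>{i\<in>I. q i = x}. g i)" for g :: "_ \<Rightarrow> complex"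
    by (rule sum.image_gen[OF assms(2)])
  have "(\<Sum>i\<in>I. \<Sum>j\<in>I. cnj (v i) * v j * A (q i, q j))
      = (\<Sum>x\<in>q ` I. \<Sum>i\<in>{i\<in>I. q i = x}. \<Sum>y\<in>q ` I. \<Sum>j\<in>{j\<in>I. q j = y}. cnj (v i) * v j * A (x, y))"
    by (subst group, rule sum.cong[OF refl], rule sum.cong[OF refl], subst group,
        intro sum.cong refl) auto
  also have "\<dots> = (\<Sum>x\<in>q ` I. \<Sum>y\<in>q ` I. cnj (w x) * w y * A (x, y))"
  proof (intro sum.cong[OF refl])
    fix x
    have "(\<Sum>i\<in>{i\<in>I. q i = x}. \<Sum>y\<in>q ` I. \<Sum>j\<in>{j\<in>I. q j = y}. cnj (v i) * v j * A (x, y))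
      = (\<Sum>y\<in>q ` I. \<Sum>i\<in>{i\<in>I. q i = x}. \<Sum>j\<in>{j\<in>I. q j = y}. cnj (v i) * v j * A (x, y))"
      by (rule sum.swap)
    also have "\<dots> = (\<Sum>y\<in>q ` I. cnj (w x) * w y * A (x, y))"
      unfolding w_def cnj_sum sum_distrib_left sum_distrib_right
      by (intro sum.cong refl sum.swap)
    finally show "(\<Sum>i\<in>{i\<in>I. q i = x}. \<Sum>y\<in>q ` I. \<Sum>j\<in>{j\<in>I. q j = y}. cnj (v i) * v j * A (x, y)) = \<dots>" .
  qed
  finally show ?thesis using assms by (simp add: psd_def)
qed

text \<open>A quadratic polynomial in the coefficient \<open>a\<close> at \<open>p\<close>. Since
  \<open>p\<close> may already lie in \<open>S\<close>, the sum is pulled back from an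
  option-indexed family in which \<open>None\<close> is the extra copy of \<open>p\<close>.\<close>

lemma psd_extend:
  assumes "psd A" "finite S"
  shows "cnonneg (cnj a * a * A (p, p) + cnj a * (\<Sum>y\<in>S. v y * A (p, y))
     + a * (\<Sum>x\<in>S. cnj (v x) * A (x, p)) + (\<Sum>x\<in>S. \<Sum>y\<in>S. cnj (v x) * v y * A (x, y)))"
proof -
  let ?I = "insert None (Some ` S)"
  let ?q = "case_option p id" and ?v = "case_option a v"
  have "cnonneg (\<Sum>i\<in>?I. \<Sum>j\<in>?I. cnj (?v i) * ?v j * A (?q i, ?q j))"
    by (rule psd_pullback) (use assms in auto)
  also have "(\<Sum>i\<in>?I. \<Sum>j\<in>?I. cnj (?v i) * ?v j * A (?q i, ?q j)) =
     cnj a * a * A (p, p) + cnj a * (\<Sum>y\<in>S. v y * A (p, y))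
     + a * (\<Sum>x\<in>S. cnj (v x) * A (x, p)) + (\<Sum>x\<in>S. \<Sum>y\<in>S. cnj (v x) * v y * A (x, y))"
    using assms(2) by (simp add: sum.insert sum.reindex sum.distrib sum_distrib_left algebra_simps)
  finally show ?thesis .
qed

lemma psd_diag: "psd A \<Longrightarrow> cnonneg (A (x, x))"
  using psd_extend[of A "{}" 1 x] by simp

lemma psd_hermitian:
  assumes "psd A"
  shows "A (y, x) = cnj (A (x, y))"
proof -
  have gen: "cnonneg (cnj a * a * A (x, x) + cnj a * A (x, y) + a * A (y, x) + A (y, y))" for a
    using psd_extend[OF assms, of "{y}" a x "\<lambda>_. 1"] by simp
  \<comment> \<open>Reality at \<open>a = 1\<close> makes the imaginary parts of
    \<open>A (x, y)\<close> and \<open>A (y, x)\<close> opposite; reality at \<open>a = \<i>\<close>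
    makes the real parts equal.\<close>
  from gen[of 1] gen[of \<i>] psd_diag[OF assms, of x] psd_diag[OF assms, of y]
  show ?thesis by (simp add: complex_eq_iff cnonneg_def)
qed

text \<open>Without its quadratic term the polynomial of \<open>psd_extend\<close> is real-affine in
  \<open>a\<close>, and it stays nonnegative only if its slope vanishes.\<close>

lemma psd_null:
  assumes "psd A" "A (p, p) = 0"
  shows "A (p, y) = 0"
proof (rule ccontr)
  assume nz: "A (p, y) \<noteq> 0"
  define m where "m = (cmod (A (p, y)))\<^sup>2"
  have m: "m > 0" using nz by (simp add: m_def)
  \<comment> \<open>With this \<open>r\<close> the form has real part
    \<open>- Re (A (y, y)) - 2\<close>, which is negative.\<close>
  define r where "r = (Re (A (y, y)) + 1) / m"
  have "cnonneg (cnj (- of_real r * A (p, y)) * A (p, y) + (- of_real r * A (p, y)) * cnj (A (p, y)) + A (y, y))"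
    using psd_extend[OF assms(1), of "{y}" "- of_real r * A (p, y)" p "\<lambda>_. 1"] assms(2)
      psd_hermitian[OF assms(1), of y p] by simp
  moreover have "cnj (- of_real r * A (p, y)) * A (p, y) + (- of_real r * A (p, y)) * cnj (A (p, y))
     = of_real (- 2 * r * m)"
    using complex_norm_square[of "A (p, y)"] by (simp add: m_def algebra_simps)
  ultimately have "cnonneg (of_real (- 2 * r * m) + A (y, y))" by metis
  then have "0 \<le> - 2 * (r * m) + Re (A (y, y))" by (simp add: cnonneg_def)
  moreover have "r * m = Re (A (y, y)) + 1" using m by (simp add: r_def)
  moreover have "Re (A (y, y)) \<ge> 0" using psd_diag[OF assms(1), of y] by (simp add: cnonneg_def)
  ultimately show False by simp
qed

text \<open>The minimum over \<open>a\<close> of the polynomial in \<open>psd_extend\<close>,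
  attained at \<open>a = - b / A (p, p)\<close>, is the value of this form.\<close>

lemma psd_schur_complement:
  assumes A: "psd A" and nz: "A (p, p) \<noteq> 0"
  shows "psd (\<lambda>(x, y). A (x, y) - A (x, p) * A (p, y) / A (p, p))"
  unfolding psd_def
proof (intro allI impI)
  fix S :: "'a set" and v assume S: "finite S"
  let ?d = "A (p, p)"
  define b where "b = (\<Sum>y\<in>S. v y * A (p, y))"
  define b' where "b' = (\<Sum>x\<in>S. cnj (v x) * A (x, p))"
  have b': "b' = cnj b"
    unfolding b_def b'_def by (simp add: psd_hermitian[OF A, of _ p])
  have d: "cnj ?d = ?d" using psd_hermitian[OF A, of p p] by simp
  have "cnonneg (cnj (- (b / ?d)) * (- (b / ?d)) * ?d + cnj (- (b / ?d)) * b
     + (- (b / ?d)) * b' + (\<Sum>x\<in>S. \<Sum>y\<in>S. cnj (v x) * v y * A (x, y)))"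
    unfolding b_def b'_def by (rule psd_extend[OF A S])
  also have "cnj (- (b / ?d)) * (- (b / ?d)) * ?d + cnj (- (b / ?d)) * b + (- (b / ?d)) * b' = - (b' * b / ?d)"
    using nz by (simp add: b' d field_simps)
  also have "- (b' * b / ?d) + (\<Sum>x\<in>S. \<Sum>y\<in>S. cnj (v x) * v y * A (x, y))
      = (\<Sum>x\<in>S. \<Sum>y\<in>S. cnj (v x) * v y * (case (x, y) of (x, y) \<Rightarrow> A (x, y) - A (x, p) * A (p, y) / ?d))"
    unfolding b_def b'_def sum_product
    by (simp add: right_diff_distrib sum_subtractf sum_divide_distrib mult_ac)
  finally show "cnonneg (\<Sum>x\<in>S. \<Sum>y\<in>S. cnj (v x) * v y * (case (x, y) of (x, y) \<Rightarrow> A (x, y) - A (x, p) * A (p, y) / ?d))" .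
qed

section \<open>The Schur product theorem\<close>

lemma psd_restrict:
  assumes "psd A"
  shows "psd (\<lambda>(x, y). if x \<in> S \<and> y \<in> S then A (x, y) else 0)"
  unfolding psd_def
proof (intro allI impI)
  fix R :: "'a set" and v assume R: "finite R"
  have "(\<Sum>x\<in>R. \<Sum>y\<in>R. cnj (v x) * v y * (case (x, y) of (x, y) \<Rightarrow> if x \<in> S \<and> y \<in> S then A (x, y) else 0))
     = (\<Sum>x\<in>R. \<Sum>y\<in>R. cnj (if x \<in> S then v x else 0) * (if y \<in> S then v y else 0) * A (x, y))"
    by (intro sum.cong refl) auto
  then show "cnonneg (\<Sum>x\<in>R. \<Sum>y\<in>R. cnj (v x) * v y * (case (x, y) of (x, y) \<Rightarrow> if x \<in> S \<and> y \<in> S then A (x, y) else 0))"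
    using assms R by (simp only: psd_def)
qed

text \<open>Splitting off one rank-one summand of \<open>A\<close> per index (Cholesky) reduces the claim to rank-one \<open>A\<close>.\<close>

lemma schur_product_supported:
  assumes B: "psd B" and I: "finite I" and "finite S"
    and "psd A" "\<And>x y. x \<notin> S \<or> y \<notin> S \<Longrightarrow> A (x, y) = 0"
  shows "cnonneg (\<Sum>i\<in>I. \<Sum>j\<in>I. cnj (v i) * v j * (A (p i, p j) * B (q i, q j)))"
  using assms(3-5)
proof (induction S arbitrary: A rule: finite_induct)
  case empty
  then show ?case by (simp add: cnonneg_def)
next
  case (insert z S)
  note A = \<open>psd A\<close>
  show ?case
  proof (cases "A (z, z) = 0")
    \<comment> \<open>A vanishing pivot kills row and column \<open>z\<close>, so \<open>A\<close>
      is already supported on \<open>S\<close>.\<close>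
    case True
    then have "A (z, y) = 0" "A (y, z) = 0" for y
      using psd_null[OF A True, of y] psd_hermitian[OF A, of y z] by auto
    then have "A (x, y) = 0" if "x \<notin> S \<or> y \<notin> S" for x y
      using that insert.prems(2)[of x y] by (cases "x = z \<or> y = z") auto
    then show ?thesis using A by (intro insert.IH) auto
  next
    case False
    define d where "d = Re (A (z, z))"
    have d: "A (z, z) = of_real d" "d > 0"
      using psd_diag[OF A, of z] False by (auto simp: d_def cnonneg_def complex_eq_iff)
    \<comment> \<open>Eliminating the pivot clears row and column \<open>z\<close>, so the induction
      hypothesis applies to \<open>A'\<close>.\<close>
    define A' where "A' = (\<lambda>(x, y). A (x, y) - A (x, z) * A (z, y) / A (z, z))"
    have "cnonneg (\<Sum>i\<in>I. \<Sum>j\<in>I. cnj (v i) * v j * (A' (p i, p j) * B (q i, q j)))"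
    proof (rule insert.IH)
      show "psd A'" unfolding A'_def by (rule psd_schur_complement[OF A False])
      show "A' (x, y) = 0" if "x \<notin> S \<or> y \<notin> S" for x y
        using that insert.prems(2)[of x y] insert.prems(2)[of x z] insert.prems(2)[of z y] False
        by (cases "x = z"; cases "y = z") (simp_all add: A'_def, blast)
    qed
    \<comment> \<open>The rank-one part removed from \<open>A\<close> is
      \<open>cnj (a x) * a y\<close>. Its factors are absorbed into the coefficients, leaving a
      pullback of \<open>B\<close>.\<close>
    moreover define a where "a y = A (z, y) / of_real (sqrt d)" for y
    have a: "A (x, z) * A (z, y) / A (z, z) = cnj (a x) * a y" for x y
      using d(2) by (simp add: a_def d(1) psd_hermitian[OF A, of x z] field_simps
          of_real_mult[symmetric] power2_eq_square[symmetric]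
          of_real_power[symmetric] del: of_real_mult of_real_power)
    have "cnonneg (\<Sum>i\<in>I. \<Sum>j\<in>I. cnj (v i * a (p i)) * (v j * a (p j)) * B (q i, q j))"
      by (rule psd_pullback[OF B I])
    ultimately have "cnonneg ((\<Sum>i\<in>I. \<Sum>j\<in>I. cnj (v i) * v j * (A' (p i, p j) * B (q i, q j)))
       + (\<Sum>i\<in>I. \<Sum>j\<in>I. cnj (v i * a (p i)) * (v j * a (p j)) * B (q i, q j)))"
      by (rule cnonneg_add)
    also have "(\<Sum>i\<in>I. \<Sum>j\<in>I. cnj (v i) * v j * (A' (p i, p j) * B (q i, q j)))
       + (\<Sum>i\<in>I. \<Sum>j\<in>I. cnj (v i * a (p i)) * (v j * a (p j)) * B (q i, q j))
       = (\<Sum>i\<in>I. \<Sum>j\<in>I. cnj (v i) * v j * (A (p i, p j) * B (q i, q j)))"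
      unfolding sum.distrib[symmetric]
    proof (intro sum.cong refl)
      fix i j
      have "A (p i, p j) = A' (p i, p j) + cnj (a (p i)) * a (p j)"
        by (simp add: A'_def a)
      then show "cnj (v i) * v j * (A' (p i, p j) * B (q i, q j)) + cnj (v i * a (p i)) * (v j * a (p j)) * B (q i, q j)
        = cnj (v i) * v j * (A (p i, p j) * B (q i, q j))"
        by (simp add: algebra_simps)
    qed
    finally show ?thesis .
  qed
qed

text \<open>Only the finitely many points \<open>p i\<close> occur, so \<open>A\<close> may be cut
  off elsewhere to obtain finite support.\<close>

lemma schur_product:
  assumes A: "psd A" and B: "psd B" and I: "finite I"
  shows "cnonneg (\<Sum>i\<in>I. \<Sum>j\<in>I. cnj (v i) * v j * (A (p i, p j) * B (q i, q j)))"
proof -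
  define A' where "A' = (\<lambda>(x, y). if x \<in> p ` I \<and> y \<in> p ` I then A (x, y) else 0)"
  have "cnonneg (\<Sum>i\<in>I. \<Sum>j\<in>I. cnj (v i) * v j * (A' (p i, p j) * B (q i, q j)))"
    by (rule schur_product_supported[OF B I, of "p ` I"])
      (use I psd_restrict[OF A, of "p ` I"] in \<open>auto simp: A'_def\<close>)
  then show ?thesis by (simp add: A'_def)
qed

lemma psd_rank_one: "psd (\<lambda>(x, y). cnj (a x) * a y)"
  unfolding psd_def
proof (intro allI impI)
  fix S :: "'a set" and v
  have "(\<Sum>x\<in>S. \<Sum>y\<in>S. cnj (v x) * v y * (case (x, y) of (x, y) \<Rightarrow> cnj (a x) * a y))
     = cnj (\<Sum>x\<in>S. v x * a x) * (\<Sum>y\<in>S. v y * a y)"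
    unfolding cnj_sum sum_product by (simp add: mult_ac)
  then show "cnonneg (\<Sum>x\<in>S. \<Sum>y\<in>S. cnj (v x) * v y * (case (x, y) of (x, y) \<Rightarrow> cnj (a x) * a y))"
    by (simp only: cnonneg_cnj_mult)
qed

subsection \<open>Evaluating functionals on tensor words\<close>

lemma fapp_superset: "finite A \<Longrightarrow> supp v \<subseteq> A \<Longrightarrow> fapp g v = (\<Sum>k\<in>A. v k * g k)"
  unfolding fapp_def by (rule sum.mono_neutral_left) (auto simp: supp_def)

lemma supp_sing [simp]: "supp (sing k) = {k}"
  by (auto simp: supp_def sing_def)

lemma fapp_sing [simp]: "fapp g (sing k) = g k"
  unfolding fapp_def supp_sing by (simp add: sing_def)

lemma fapp_cong: "(\<And>k. k \<in> supp v \<Longrightarrow> f k = g k) \<Longrightarrow> fapp f v = fapp g v"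
  by (simp add: fapp_def)

lemma fapp_tens_cong: "tens n v \<Longrightarrow> (\<And>k. length k = n \<Longrightarrow> f k = g k) \<Longrightarrow> fapp f v = fapp g v"
  by (rule fapp_cong) (auto simp: tens_def)

lemma fapp_swap: "fapp (\<lambda>k. fapp (\<lambda>l. g k l) w) v = fapp (\<lambda>l. fapp (\<lambda>k. g k l) v) w"
  unfolding fapp_def sum_distrib_left by (subst sum.swap) (simp add: mult_ac)

lemma fapp_mult_left: "fapp (\<lambda>k. a * g k) v = a * fapp g v"
  unfolding fapp_def sum_distrib_left by (simp add: mult_ac)

lemma fapp_mult_right: "fapp (\<lambda>k. g k * a) v = fapp g v * a"
  unfolding fapp_def sum_distrib_right by (simp add: mult_ac)

lemma fapp_add: "fapp (\<lambda>k. f k + g k) v = fapp f v + fapp g v"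
  by (simp add: fapp_def algebra_simps sum.distrib)

lemma supp_app: "supp (app f v) \<subseteq> (\<Union>k\<in>supp v. supp (f k))"
proof
  fix l assume "l \<in> supp (app f v)"
  then have "(\<Sum>k\<in>supp v. v k * f k l) \<noteq> 0" by (simp add: supp_def app_def)
  then obtain k where "k \<in> supp v" "v k * f k l \<noteq> 0" by (rule sum.not_neutral_contains_not_neutral)
  then show "l \<in> (\<Union>k\<in>supp v. supp (f k))" by (auto simp: supp_def)
qed

lemma finite_supp_app:
  assumes "finite (supp v)" "\<And>k. k \<in> supp v \<Longrightarrow> finite (supp (f k))"
  shows "finite (supp (app f v))"
  by (rule finite_subset[OF supp_app]) (use assms in auto)

text \<open>Cancellation can make the support of \<open>app f v\<close> smaller than the union of
  the supports of the \<open>f k\<close>, so the sums are taken over that union.\<close>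

lemma fapp_app:
  assumes "finite (supp v)" "\<And>k. k \<in> supp v \<Longrightarrow> finite (supp (f k))"
  shows "fapp g (app f v) = fapp (\<lambda>k. fapp g (f k)) v"
proof -
  let ?A = "\<Union>k\<in>supp v. supp (f k)"
  have A: "finite ?A" using assms by auto
  have "fapp g (app f v) = (\<Sum>l\<in>?A. \<Sum>k\<in>supp v. v k * (f k l * g l))"
    unfolding fapp_superset[OF A supp_app] by (simp add: app_def sum_distrib_left mult_ac)
  also have "\<dots> = (\<Sum>k\<in>supp v. v k * (\<Sum>l\<in>?A. f k l * g l))"
    unfolding sum_distrib_left by (rule sum.swap)
  also have "\<dots> = (\<Sum>k\<in>supp v. v k * fapp g (f k))"
    by (intro sum.cong refl arg_cong2[where f = "(*)"] fapp_superset[symmetric] A) auto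
  finally show ?thesis by (simp only: fapp_def[of _ v])
qed

section \<open>Tensor products and composition\<close>

lemma supp_tvm:
  assumes "tens m v"
  shows "supp (tvm m v w) = (\<lambda>(x, y). x @ y) ` (supp v \<times> supp w)"
proof (intro equalityI subsetI)
  fix k assume "k \<in> supp (tvm m v w)"
  then have "(take m k, drop m k) \<in> supp v \<times> supp w" by (auto simp: supp_def tvm_def)
  moreover have "k = (\<lambda>(x, y). x @ y) (take m k, drop m k)" by simp
  ultimately show "k \<in> (\<lambda>(x, y). x @ y) ` (supp v \<times> supp w)" by (rule rev_image_eqI)
next
  fix k assume "k \<in> (\<lambda>(x, y). x @ y) ` (supp v \<times> supp w)"
  then show "k \<in> supp (tvm m v w)" using assms by (auto simp: tens_def supp_def tvm_def)
qed

text \<open>All words of \<open>v\<close> have length \<open>m\<close>, so concatenation is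
  injective on pairs of supporting words and the sum becomes iterated.\<close>

lemma fapp_tvm:
  assumes "tens m v"
  shows "fapp g (tvm m v w) = fapp (\<lambda>x. fapp (\<lambda>y. g (x @ y)) w) v"
proof -
  have inj: "inj_on (\<lambda>(x, y). x @ y) (supp v \<times> supp w)"
    using assms by (auto simp: inj_on_def tens_def)
  have "fapp g (tvm m v w) = (\<Sum>(x, y)\<in>supp v \<times> supp w. v x * (w y * g (x @ y)))"
    unfolding fapp_def[of g] supp_tvm[OF assms]
    using assms by (subst sum.reindex[OF inj]) (auto intro!: sum.cong simp: tvm_def tens_def)
  also have "\<dots> = fapp (\<lambda>x. fapp (\<lambda>y. g (x @ y)) w) v"
    by (simp add: fapp_def sum_distrib_left sum.cartesian_product)
  finally show ?thesis .
qed

lemma tens_sing: "length k = n \<Longrightarrow> tens n (sing k)"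
  by (simp add: tens_def)

lemma tens_tvm: "tens m v \<Longrightarrow> tens n w \<Longrightarrow> tens (m + n) (tvm m v w)"
  unfolding tens_def[of "m + n"] using supp_tvm[of m v w] by (auto simp: tens_def)

lemma tens_app: "tens m v \<Longrightarrow> lmap m n f \<Longrightarrow> tens n (app f v)"
  unfolding tens_def[of n] using finite_supp_app[of v f] supp_app[of f v]
  unfolding tens_def lmap_def by blast

lemma lmap_tens: "lmap m n f \<Longrightarrow> length k = m \<Longrightarrow> tens n (f k)"
  by (simp add: lmap_def)

lemma lmap_idm: "lmap n n idm"
  by (simp add: lmap_def idm_def tens_sing)

lemma lmap_comp: "lmap m n g \<Longrightarrow> lmap n p f \<Longrightarrow> lmap m p (comp f g)"
  unfolding comp_def using tens_app[of n _ p f] by (simp add: lmap_def)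

lemma lmap_tensm:
  "lmap m n f \<Longrightarrow> lmap p q g \<Longrightarrow> a = m + p \<Longrightarrow> b = n + q \<Longrightarrow> lmap a b (tensm m n f g)"
  unfolding lmap_def tensm_def by (simp add: tens_tvm)

lemma lmap_fmap: "lmap n 0 (fmap f)"
proof -
  have "supp (fmap f k) \<subseteq> {[]}" for k by (auto simp: supp_def fmap_def)
  then show ?thesis unfolding lmap_def tens_def by (auto intro: finite_subset)
qed

lemma fapp_idm [simp]: "fapp g (idm k) = g k"
  by (simp add: idm_def)

lemma fapp_lmap_app: "tens m v \<Longrightarrow> lmap m n f \<Longrightarrow> fapp g (app f v) = fapp (\<lambda>k. fapp g (f k)) v"
  by (rule fapp_app) (auto simp: tens_def lmap_def)

lemma fapp_comp:
  "lmap m n g \<Longrightarrow> lmap n p f \<Longrightarrow> length k = m \<Longrightarrow> fapp h (comp f g k) = fapp (\<lambda>l. fapp h (f l)) (g k)"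
  unfolding comp_def by (rule fapp_lmap_app[of n _ p]) (rule lmap_tens)

lemma fapp_tensm:
  assumes "lmap m n f" "m \<le> length k"
  shows "fapp h (tensm m n f g k) = fapp (\<lambda>x. fapp (\<lambda>y. h (x @ y)) (g (drop m k))) (f (take m k))"
  using assms by (simp add: tensm_def fapp_tvm lmap_def)

lemma fapp_scalar:
  assumes "tens 0 v"
  shows "fapp g v = v [] * g []"
  using fapp_superset[of "{[]}" v g] assms by (auto simp: tens_def)

text \<open>Conjugating coefficients turns the antilinear extension \<open>aapp\<close> into the
  linear one, so the calculus for \<open>app\<close> applies to the involution.\<close>

definition conj_vec :: "'i vec \<Rightarrow> 'i vec" where
  "conj_vec v = (\<lambda>k. cnj (v k))"

lemma supp_conj_vec [simp]: "supp (conj_vec v) = supp v"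
  by (simp add: supp_def conj_vec_def)

lemma tens_conj_vec [simp]: "tens n (conj_vec v) = tens n v"
  by (simp add: tens_def)

lemma aapp_eq_app: "aapp f v = app f (conj_vec v)"
  by (simp add: aapp_def app_def) (simp add: conj_vec_def)

lemma fapp_conj_vec: "fapp g (conj_vec v) = cnj (fapp (\<lambda>k. cnj (g k)) v)"
  by (simp add: fapp_def) (simp add: conj_vec_def)

section \<open>Letters in place of words; quadratic forms of vectors\<close>

abbreviation fapp1 :: "('i \<Rightarrow> complex) \<Rightarrow> 'i vec \<Rightarrow> complex" where
  "fapp1 g v \<equiv> fapp (\<lambda>k. g (k ! 0)) v"

abbreviation fapp2 :: "('i \<Rightarrow> 'i \<Rightarrow> complex) \<Rightarrow> 'i vec \<Rightarrow> complex" where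
  "fapp2 g v \<equiv> fapp (\<lambda>k. g (k ! 0) (k ! 1)) v"

lemma word_1: "length k = Suc 0 \<Longrightarrow> [k ! 0] = k"
  by (rule nth_equalityI) auto

lemma word_2: "length k = 2 \<Longrightarrow> [k ! 0, k ! 1] = k"
  by (cases k; cases "tl k") auto

lemma fapp_letter: "tens 1 v \<Longrightarrow> fapp g v = fapp1 (\<lambda>x. g [x]) v"
  by (rule fapp_tens_cong[where n = 1], assumption) (simp add: word_1)

lemma fapp_letters2: "tens 2 v \<Longrightarrow> fapp g v = fapp2 (\<lambda>x y. g [x, y]) v"
  by (rule fapp_tens_cong[where n = 2], assumption) (simp add: word_2[simplified])

lemma fapp_sums: "(\<And>k. (\<lambda>n. f n k) sums g k) \<Longrightarrow> (\<lambda>n. fapp (f n) v) sums fapp g v"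
  unfolding fapp_def by (intro sums_sum sums_mult)

lemma fapp_tendsto: "(\<And>k. ((\<lambda>n. f n k) \<longlongrightarrow> g k) A) \<Longrightarrow> ((\<lambda>n. fapp (f n) v) \<longlongrightarrow> fapp g v) A"
  unfolding fapp_def by (intro tendsto_intros)

lemma fapp_diff: "fapp (\<lambda>k. f k - g k) v = fapp f v - fapp g v"
  by (simp add: fapp_def algebra_simps sum_subtractf)

lemma fapp_divide: "fapp (\<lambda>k. g k / a) v = fapp g v / a"
  by (simp add: fapp_def sum_divide_distrib)

lemma fapp_diff_vec:
  assumes "finite (supp v)" "finite (supp w)"
  shows "fapp g (\<lambda>k. v k - a * w k) = fapp g v - a * fapp g w"
proof -
  let ?A = "supp v \<union> supp w"
  have "finite ?A" "supp (\<lambda>k. v k - a * w k) \<subseteq> ?A" "supp v \<subseteq> ?A" "supp w \<subseteq> ?A"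
    using assms by (auto simp: supp_def)
  then show ?thesis
    by (simp add: fapp_superset[of ?A] sum_distrib_left algebra_simps sum_subtractf)
qed

text \<open>The sesquilinear extension of \<open>A\<close>, antilinear in its first slot, on the
  diagonal \<open>(b, b)\<close>.\<close>

definition sesq :: "('i \<times> 'i \<Rightarrow> complex) \<Rightarrow> 'i vec \<Rightarrow> complex" where
  "sesq A b = fapp1 (\<lambda>x. fapp1 (\<lambda>y. A (x, y)) b) (conj_vec b)"

lemma psd_sesq: "psd A \<Longrightarrow> tens 1 b \<Longrightarrow> cnonneg (sesq A b)"
  using psd_pullback[of A "supp b" b "\<lambda>k. k ! 0"]
  unfolding sesq_def fapp_def supp_conj_vec tens_def
  by (simp add: conj_vec_def sum_distrib_left mult_ac)

lemma psd_if_sesq: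
  assumes "\<And>b. tens 1 b \<Longrightarrow> cnonneg (sesq A b)"
  shows "psd A"
  unfolding psd_def
proof (intro allI impI)
  fix S :: "'a set" and v assume S: "finite S"
  define b :: "'a vec" where "b k = (if length k = 1 \<and> k ! 0 \<in> S then v (k ! 0) else 0)" for k
  have sub: "supp b \<subseteq> (\<lambda>x. [x]) ` S"
  proof
    fix k assume "k \<in> supp b"
    then have k: "length k = Suc 0" "k ! 0 \<in> S" by (auto simp: supp_def b_def split: if_splits)
    then show "k \<in> (\<lambda>x. [x]) ` S" using word_1[OF k(1)] by (metis image_eqI)
  qed
  have inj: "inj_on (\<lambda>x. [x]) S" by (simp add: inj_on_def)
  have b: "fapp1 h b = (\<Sum>x\<in>S. v x * h x)" for h
    using S sub by (simp add: fapp_superset[of "(\<lambda>x. [x]) ` S"] sum.reindex[OF inj] b_def)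
  have cb: "fapp1 h (conj_vec b) = (\<Sum>x\<in>S. cnj (v x) * h x)" for h
    by (simp add: fapp_conj_vec b[of "\<lambda>x. cnj (h x)"])
  have "tens 1 b"
    unfolding tens_def using finite_subset[OF sub] sub S by auto
  then have "cnonneg (sesq A b)" by (rule assms)
  also have "sesq A b = (\<Sum>x\<in>S. \<Sum>y\<in>S. cnj (v x) * v y * A (x, y))"
    unfolding sesq_def b[of "\<lambda>y. A (x, y)" for x] cb[of "\<lambda>x. \<Sum>y\<in>S. v y * A (x, y)"]
    by (simp add: sum_distrib_left mult_ac)
  finally show "cnonneg (\<Sum>x\<in>S. \<Sum>y\<in>S. cnj (v x) * v y * A (x, y))" .
qed

lemma sesq_tendsto:
  "(\<And>x y. ((\<lambda>n. A n (x, y)) \<longlongrightarrow> B (x, y)) Z) \<Longrightarrow> ((\<lambda>n. sesq (A n) b) \<longlongrightarrow> sesq B b) Z"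
  unfolding sesq_def by (intro fapp_tendsto)

lemma tendsto_product_quotient:
  fixes a b :: "real \<Rightarrow> complex"
  assumes a: "((\<lambda>t. (a t - a0) / of_real t) \<longlongrightarrow> a') (at 0)"
    and b: "((\<lambda>t. (b t - b0) / of_real t) \<longlongrightarrow> b') (at 0)"
  shows "((\<lambda>t. (a t * b t - a0 * b0) / of_real t) \<longlongrightarrow> a' * b0 + a0 * b') (at 0)"
proof -
  \<comment> \<open>For \<open>t \<noteq> 0\<close> this expression is \<open>b t\<close>, so
    convergence of the quotient yields the continuity of \<open>b\<close> that the product rule
    needs.\<close>
  have "((\<lambda>t. (b t - b0) / of_real t * of_real t + b0) \<longlongrightarrow> b' * of_real 0 + b0) (at 0)"
    by (intro tendsto_intros b)
  then have "((\<lambda>t. (b t - b0) / of_real t * of_real t + b0) \<longlongrightarrow> b0) (at 0)"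
    by (rule tendsto_eq_rhs) simp
  then have "(b \<longlongrightarrow> b0) (at 0)"
    by (rule Lim_transform_eventually) (auto simp: eventually_at_filter)
  then have "((\<lambda>t. (a t - a0) / of_real t * b t + a0 * ((b t - b0) / of_real t)) \<longlongrightarrow> a' * b0 + a0 * b') (at 0)"
    by (intro tendsto_intros a b)
  then show ?thesis
    by (rule Lim_transform_eventually) (auto simp: eventually_at_filter field_simps)
qed

subsection \<open>The structure maps in coordinates\<close>

locale star_bialgebra_functional =
  fixes \<beta> \<beta>i \<mu> u \<Delta> \<delta> s :: "'i lmap" and \<mu>t :: "real \<Rightarrow> 'i lmap" and L \<psi> :: "'i fnl"
  assumes bialg: "braided_star_bialg \<beta> \<beta>i \<mu> u \<Delta> \<delta> s"
    and deform: "additive_deformation \<beta> \<mu> u \<Delta> \<delta> \<mu>t"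
    and gen: "is_generator \<delta> \<mu>t L"
    and herm: "\<forall>k. length k = 1 \<longrightarrow> fapp \<psi> (s k) = cnj (\<psi> k)"
    and binv: "meq 2 (comp (tensm 1 0 (fmap \<psi>) idm) \<beta>) (tensm 1 1 idm (fmap \<psi>))"
    and unit0: "fapp \<psi> (u []) = 0"
begin

lemma lmaps:
  shows beta: "lmap 2 2 \<beta>" and Delta: "lmap (Suc 0) 2 \<Delta>" and counit: "lmap (Suc 0) 0 \<delta>"
    and star: "lmap (Suc 0) (Suc 0) s" and unit: "lmap 0 (Suc 0) u"
    and mut: "lmap 2 (Suc 0) (\<mu>t t)"
  using bialg deform
  by (auto simp: braided_star_bialg_def braided_bialg_def braided_def braided_unital_alg_def
      additive_deformation_def)

text \<open>Values of the structure maps at basis letters are recorded through their action on arbitrary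
  functionals: in Sweedler notation \<open>D x h\<close> is the sum of \<open>h x\<^sub>1 x\<^sub>2\<close> over \<open>\<Delta> x\<close>, and \<open>m t x y h\<close> is
  \<open>h (\<mu>\<^sub>t(x \<otimes> y))\<close>. Nesting them then composes the maps without any index bookkeeping.\<close>

definition "D x h = fapp2 h (\<Delta> [x])"
definition "B x y h = fapp2 h (\<beta> [x, y])"
definition "S x h = fapp1 h (s [x])"
definition "U h = fapp1 h (u [])"
definition "m t x y h = fapp1 h (\<mu>t t [x, y])"
abbreviation "d x \<equiv> \<delta> [x] []"

section \<open>Bialgebra axioms on basis letters\<close>

lemma Delta_letters: "fapp g (\<Delta> [x]) = D x (\<lambda>y z. g [y, z])"
  unfolding D_def by (intro fapp_letters2 lmap_tens[OF Delta]) simp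

lemma beta_letters: "fapp g (\<beta> [x, y]) = B x y (\<lambda>y z. g [y, z])"
  unfolding B_def by (intro fapp_letters2 lmap_tens[OF beta]) simp

lemma mut_letters: "fapp g (\<mu>t t [x, y]) = m t x y (\<lambda>z. g [z])"
  unfolding m_def by (intro fapp_letter) (simp add: lmap_tens[OF mut])

lemma star_letters: "fapp g (s [x]) = S x (\<lambda>z. g [z])"
  unfolding S_def by (intro fapp_letter) (simp add: lmap_tens[OF star])

lemma unit_letters: "fapp g (u []) = U (\<lambda>z. g [z])"
  unfolding U_def by (intro fapp_letter) (simp add: lmap_tens[OF unit])

lemma counit_letter: "fapp g (\<delta> [x]) = d x * g []"
  by (intro fapp_scalar lmap_tens[OF counit]) simp

lemma mut_0: "\<mu>t 0 = \<mu>"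
  using deform by (simp add: additive_deformation_def)

lemmas letters = Delta_letters beta_letters mut_letters star_letters unit_letters counit_letter

text \<open>As for the axioms below, an arbitrary functional is evaluated on both sides of the
  identity of maps at a basis word, and composites unfold into nested evaluations.\<close>

lemma coassoc: "D x (\<lambda>y z. D y (\<lambda>p q. h p q z)) = D x (\<lambda>y z. D z (\<lambda>p q. h y p q))"
proof -
  have *: "lmap 2 3 (tensm 1 2 \<Delta> idm)" "lmap 2 3 (tensm 1 1 idm \<Delta>)"
    by (auto intro!: lmap_tensm lmaps lmap_idm)
  have "comp (tensm 1 2 \<Delta> idm) \<Delta> [x] = comp (tensm 1 1 idm \<Delta>) \<Delta> [x]"
    using bialg by (auto simp: braided_star_bialg_def braided_bialg_def meq_def)
  from arg_cong[OF this, of "fapp (\<lambda>k. h (k!0) (k!1) (k!2))"]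
  show ?thesis
    by (simp add: fapp_comp[OF Delta *(1)[simplified]] fapp_comp[OF Delta *(2)[simplified]]
        letters fapp_tensm[OF Delta] fapp_tensm[OF lmap_idm])
qed


lemma counit_l: "D x (\<lambda>y z. d y * h z) = h x"
proof -
  have *: "lmap 2 (Suc 0) (tensm 1 0 \<delta> idm)"
    by (auto intro!: lmap_tensm lmaps lmap_idm)
  have "comp (tensm 1 0 \<delta> idm) \<Delta> [x] = idm [x]"
    using bialg by (auto simp: braided_star_bialg_def braided_bialg_def meq_def)
  from arg_cong[OF this, of "fapp (\<lambda>k. h (k!0))"]
  show ?thesis
    by (simp add: fapp_comp[OF Delta *[simplified]] letters fapp_tensm[OF counit])
qed

lemma counit_r: "D x (\<lambda>y z. h y * d z) = h x"
proof -
  have *: "lmap 2 (Suc 0) (tensm 1 1 idm \<delta>)"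
    by (auto intro!: lmap_tensm lmaps lmap_idm)
  have "comp (tensm 1 1 idm \<delta>) \<Delta> [x] = idm [x]"
    using bialg by (auto simp: braided_star_bialg_def braided_bialg_def meq_def)
  from arg_cong[OF this, of "fapp (\<lambda>k. h (k!0))"]
  show ?thesis
    by (simp add: fapp_comp[OF Delta *[simplified]] letters fapp_tensm[OF lmap_idm] mult.commute)
qed

lemma lmap_Lam: "lmap 2 4 (Lam \<beta> \<Delta>)"
  unfolding Lam_def
proof (rule lmap_comp)
  show "lmap 2 4 (tensm 1 2 \<Delta> \<Delta>)"
    by (auto intro!: lmap_tensm lmaps)
  show "lmap 4 4 (tensm 1 1 idm (tensm 2 2 \<beta> idm))"
    by (rule lmap_tensm[OF lmap_idm lmap_tensm[OF beta lmap_idm[of 1] refl refl]]) auto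
qed

lemma Lam_letters: "fapp g (Lam \<beta> \<Delta> [x, y])
    = D x (\<lambda>x1 x2. D y (\<lambda>y1 y2. B x2 y1 (\<lambda>p q. g [x1, p, q, y2])))"
proof -
  have 1: "lmap 2 4 (tensm 1 2 \<Delta> \<Delta>)"
    by (auto intro!: lmap_tensm lmaps)
  have 2: "lmap 3 3 (tensm 2 2 \<beta> idm)"
    by (auto intro!: lmap_tensm lmaps lmap_idm)
  have 3: "lmap 4 4 (tensm 1 1 idm (tensm 2 2 \<beta> idm))"
    by (rule lmap_tensm[OF lmap_idm 2]) auto
  show ?thesis
    unfolding Lam_def
    by (simp add: fapp_comp[OF 1[simplified] 3[simplified]] letters fapp_tensm[OF lmap_idm] fapp_tensm[OF Delta]
      fapp_tensm[OF beta])
qed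

lemma Delta_mut: "m (t + r) x y (\<lambda>z. D z h)
  = D x (\<lambda>x1 x2. D y (\<lambda>y1 y2. B x2 y1 (\<lambda>p q. m t x1 p (\<lambda>a. m r q y2 (\<lambda>b. h a b)))))"
proof -
  have *: "lmap 4 2 (tensm 2 1 (\<mu>t t) (\<mu>t r))"
    by (auto intro!: lmap_tensm lmaps)
  have "comp \<Delta> (\<mu>t (t + r)) [x, y] = comp (tensm 2 1 (\<mu>t t) (\<mu>t r)) (Lam \<beta> \<Delta>) [x, y]"
    using deform by (auto simp: additive_deformation_def meq_def)
  from arg_cong[OF this, of "fapp (\<lambda>k. h (k!0) (k!1))"]
  show ?thesis
    by (simp add: fapp_comp[OF mut Delta] fapp_comp[OF lmap_Lam *[simplified]] letters Lam_letters
      fapp_tensm[OF mut])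
qed

lemma Delta_unit: "U (\<lambda>z. D z h) = U (\<lambda>a. U (\<lambda>b. h a b))"
proof -
  have "comp \<Delta> u [] = tensm 0 1 u u []"
    using bialg by (auto simp: braided_star_bialg_def braided_bialg_def meq_def)
  from arg_cong[OF this, of "fapp (\<lambda>k. h (k!0) (k!1))"]
  show ?thesis
    by (simp add: fapp_comp[OF unit Delta] letters fapp_tensm[OF unit])
qed

lemma counit_mu: "m 0 x y d = d x * d y"
proof -
  have "comp \<delta> \<mu> [x, y] = tensm 1 0 \<delta> \<delta> [x, y]"
    using bialg by (auto simp: braided_star_bialg_def braided_bialg_def meq_def)
  \<comment> \<open>Both sides are scalars, supported on the empty word; the constant functional 1
    reads them off.\<close>
  from arg_cong[OF this, of "fapp (\<lambda>k. 1)"]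
  show ?thesis
    by (simp add: mut_0[symmetric] fapp_comp[OF mut counit] letters fapp_tensm[OF counit])
qed

lemma counit_unit: "U d = 1"
proof -
  have "comp \<delta> u [] = idm []"
    using bialg by (auto simp: braided_star_bialg_def braided_bialg_def meq_def)
  from arg_cong[OF this, of "fapp (\<lambda>k. 1)"]
  show ?thesis
    by (simp add: fapp_comp[OF unit counit] letters)
qed

lemma unit_mut_l: "U (\<lambda>a. m t a x h) = h x"
proof -
  have *: "lmap (Suc 0) 2 (tensm 0 1 u idm)"
    by (auto intro!: lmap_tensm lmaps lmap_idm)
  have "comp (\<mu>t t) (tensm 0 1 u idm) [x] = idm [x]"
    using deform by (auto simp: additive_deformation_def braided_unital_alg_def meq_def)
  from arg_cong[OF this, of "fapp (\<lambda>k. h (k!0))"]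
  show ?thesis
    by (simp add: fapp_comp[OF *[simplified] mut] letters fapp_tensm[OF unit])
qed

lemma unit_mut_r: "U (\<lambda>a. m t x a h) = h x"
proof -
  have *: "lmap (Suc 0) 2 (tensm 1 1 idm u)"
    by (auto intro!: lmap_tensm lmaps lmap_idm)
  have "comp (\<mu>t t) (tensm 1 1 idm u) [x] = idm [x]"
    using deform by (auto simp: additive_deformation_def braided_unital_alg_def meq_def)
  from arg_cong[OF this, of "fapp (\<lambda>k. h (k!0))"]
  show ?thesis
    by (simp add: fapp_comp[OF *[simplified] mut] letters fapp_tensm[OF lmap_idm])
qed

section \<open>Braid invariance, involution and generator on letters\<close>

lemma lmap_b1: "lmap (Suc n) (Suc n) (b1 \<beta> n)"
proof (induction n)
  case (Suc n)
  have 1: "lmap (Suc (Suc n)) (Suc (Suc n)) (tensm 1 1 idm (b1 \<beta> n))"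
    by (rule lmap_tensm[OF lmap_idm Suc]) auto
  have 2: "lmap (Suc (Suc n)) (Suc (Suc n)) (tensm 2 2 \<beta> idm)"
    by (rule lmap_tensm[OF beta lmap_idm[of n]]) auto
  show ?case unfolding b1.simps by (rule lmap_comp[OF 2 1])
qed (simp add: lmap_idm)

text \<open>The first letter is braided past its neighbour, and the resulting second letter
  \<open>q\<close> then past the remaining word.\<close>

lemma fapp_b1_Suc: "fapp g (b1 \<beta> (Suc n) (x # y # k))
   = B x y (\<lambda>p q. fapp (\<lambda>w. g (p # w)) (b1 \<beta> n (q # k)))" if "length k = n"
proof -
  have 1: "lmap (Suc (Suc n)) (Suc (Suc n)) (tensm 1 1 idm (b1 \<beta> n))"
    by (rule lmap_tensm[OF lmap_idm lmap_b1]) auto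
  have 2: "lmap (Suc (Suc n)) (Suc (Suc n)) (tensm 2 2 \<beta> idm)"
    by (rule lmap_tensm[OF beta lmap_idm[of n]]) auto
  show ?thesis using that
    by (simp add: fapp_comp[OF 2[simplified] 1[simplified]] letters fapp_tensm[OF lmap_idm] fapp_tensm[OF beta])
qed

lemma fapp_b1_0: "fapp g (b1 \<beta> 0 k) = g k"
  by simp

lemma lmap_b1_1: "lmap 2 2 (b1 \<beta> 1)"
  using lmap_b1[of 1] by (simp add: numeral_2_eq_2 del: b1.simps)

lemma lmap_b1_2: "lmap 3 3 (b1 \<beta> 2)"
  using lmap_b1[of 2] by simp

lemma beta_mut: "B a b (\<lambda>p1 p2. B p2 c (\<lambda>u v. m t p1 u (\<lambda>w. h w v))) = m t b c (\<lambda>w. B a w h)"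
proof -
  have 1: "lmap 3 2 (tensm 2 1 (\<mu>t t) idm)" and 2: "lmap 3 2 (tensm 1 1 idm (\<mu>t t))"
    by (auto intro!: lmap_tensm lmaps lmap_idm)
  have "comp (tensm 2 1 (\<mu>t t) idm) (b1 \<beta> 2) [a, b, c] = comp (b1 \<beta> 1) (tensm 1 1 idm (\<mu>t t)) [a, b, c]"
    using deform by (auto simp: additive_deformation_def braided_unital_alg_def beta_compat_def
        beta_inv_def meq_def)
  from arg_cong[OF this, of "fapp (\<lambda>k. h (k!0) (k!1))"]
  show ?thesis
    using fapp_comp[OF lmap_b1_2 1] fapp_comp[OF 2 lmap_b1_1]
    by (simp add: numeral_2_eq_2 numeral_3_eq_3 fapp_b1_Suc fapp_b1_0 letters fapp_tensm[OF lmap_idm]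
      fapp_tensm[OF mut[simplified numeral_2_eq_2]] del: b1.simps)
qed

lemma beta_Delta: "B a b (\<lambda>p q. D p (\<lambda>x y. h x y q)) = D b (\<lambda>x y. B a x (\<lambda>p q. B q y (\<lambda>p' q'. h p p' q')))"
proof -
  have 1: "lmap 2 3 (tensm 1 2 \<Delta> idm)" and 2: "lmap 2 3 (tensm 1 1 idm \<Delta>)"
    by (auto intro!: lmap_tensm lmaps lmap_idm)
  have "comp (tensm 1 2 \<Delta> idm) (b1 \<beta> 1) [a, b] = comp (b1 \<beta> 2) (tensm 1 1 idm \<Delta>) [a, b]"
    using bialg by (auto simp: braided_star_bialg_def braided_bialg_def beta_compat_def
        beta_inv_def meq_def)
  from arg_cong[OF this, of "fapp (\<lambda>k. h (k!0) (k!1) (k!2))"]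
  show ?thesis
    using fapp_comp[OF lmap_b1_1 1] fapp_comp[OF 2 lmap_b1_2]
    by (simp add: numeral_2_eq_2 numeral_3_eq_3 fapp_b1_Suc fapp_b1_0 letters fapp_tensm[OF lmap_idm]
      fapp_tensm[OF Delta[simplified numeral_2_eq_2]] del: b1.simps)
qed

lemma beta_counit: "B a b (\<lambda>p q. d p * h q) = d b * h a"
proof -
  have 1: "lmap 2 (Suc 0) (tensm 1 0 \<delta> idm)" and 2: "lmap 2 (Suc 0) (tensm 1 1 idm \<delta>)"
    by (auto intro!: lmap_tensm lmaps lmap_idm)
  have "comp (tensm 1 0 \<delta> idm) (b1 \<beta> 1) [a, b] = comp (b1 \<beta> 0) (tensm 1 1 idm \<delta>) [a, b]"
    using bialg by (auto simp: braided_star_bialg_def braided_bialg_def beta_compat_def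
        beta_inv_def meq_def)
  from arg_cong[OF this, of "fapp (\<lambda>k. h (k!0))"]
  show ?thesis
    using fapp_comp[OF lmap_b1_1 1] fapp_comp[OF 2 lmap_b1[of 0]]
    by (simp add: numeral_2_eq_2 fapp_b1_Suc fapp_b1_0 letters fapp_tensm[OF lmap_idm]
      fapp_tensm[OF counit] del: b1.simps)
qed

lemma beta_psi: "B a b (\<lambda>p q. \<psi> [p] * h q) = \<psi> [b] * h a"
proof -
  have 1: "lmap 2 (Suc 0) (tensm 1 0 (fmap \<psi>) idm)"
    by (auto intro!: lmap_tensm lmap_fmap lmap_idm)
  have f: "fapp g (fmap \<psi> k) = \<psi> k * g []" for g k
    using fapp_scalar[of "fmap \<psi> k" g] lmap_fmap[of "length k" \<psi>] by (simp add: lmap_def) (simp add: fmap_def)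
  have "comp (tensm 1 0 (fmap \<psi>) idm) \<beta> [a, b] = tensm 1 1 idm (fmap \<psi>) [a, b]"
    using binv by (auto simp: meq_def)
  from arg_cong[OF this, of "fapp (\<lambda>k. h (k!0))"]
  show ?thesis
    by (simp add: fapp_comp[OF beta 1[simplified]] letters fapp_tensm[OF lmap_idm] fapp_tensm[OF lmap_fmap] f)
qed

text \<open>The flip places \<open>x2\<close> before \<open>x1\<close>, and the pair of conjugations
  records that the involution conjugates the coefficients of the coproduct.\<close>

lemma star_Delta: "S x (\<lambda>p. D p h)
  = cnj (D x (\<lambda>x1 x2. cnj (S x2 (\<lambda>q2. S x1 (\<lambda>q1. B q2 q1 h)))))"
proof -
  have ss: "lmap 2 2 (tensm 1 1 s s)"
    by (auto intro!: lmap_tensm lmaps)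
  have tau: "lmap 2 2 tau"
    by (auto simp: lmap_def tau_def tens_sing)
  have tau': "fapp g (tau k) = g (rev k)" for g k
    by (simp add: tau_def)
  have T: "tens 2 (\<Delta> [x])" by (rule lmap_tens[OF Delta]) simp
  have "app \<Delta> (s [x]) = app \<beta> (aapp (tensm 1 1 s s) (app tau (\<Delta> [x])))"
    using bialg by (auto simp: braided_star_bialg_def)
  from arg_cong[OF this, of "fapp (\<lambda>k. h (k!0) (k!1))"]
  show ?thesis
    using T
    by (simp add: aapp_eq_app fapp_lmap_app[OF _ Delta] fapp_lmap_app[OF _ beta] fapp_lmap_app[OF _ ss[simplified]]
      fapp_lmap_app[OF _ tau]  tens_app[OF _ ss[simplified]] tens_app[OF _ tau] lmap_tens[OF star] fapp_conj_vec
      letters fapp_tensm[OF star] tau')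
qed

lemma star_counit: "S x d = cnj (d x)"
proof -
  have "app \<delta> (s [x]) [] = cnj (d x)"
    using bialg by (auto simp: braided_star_bialg_def)
  moreover have "app \<delta> (s [x]) [] = fapp (\<lambda>_. 1) (app \<delta> (s [x]))"
    by (subst fapp_scalar) (auto intro!: tens_app[OF _ counit] lmap_tens[OF star])
  ultimately show ?thesis
    by (simp add: fapp_lmap_app[OF _ counit] lmap_tens[OF star] letters)
qed

lemma star_unit: "cnj (U (\<lambda>x. cnj (S x h))) = U h"
proof -
  have "aapp s (u []) = u []"
    using bialg by (auto simp: braided_star_bialg_def)
  from arg_cong[OF this, of "fapp (\<lambda>k. h (k!0))"]
  show ?thesis
    by (simp add: aapp_eq_app fapp_lmap_app[OF _ star] lmap_tens[OF unit] fapp_conj_vec letters)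
qed

lemma star_psi: "S x (\<lambda>p. \<psi> [p]) = cnj (\<psi> [x])"
  using herm by (simp add: star_letters[symmetric])

lemma psi_unit: "U (\<lambda>p. \<psi> [p]) = 0"
  using unit0 by (simp add: unit_letters)

lemma generator: "((\<lambda>t. (m t x y d - d x * d y) / of_real t) \<longlongrightarrow> L [x, y]) (at 0)"
proof -
  have "((\<lambda>t. (app \<delta> (\<mu>t t [x, y]) [] - tensm 1 0 \<delta> \<delta> [x, y] []) / of_real t) \<longlongrightarrow> L [x, y]) (at 0)"
    using gen by (auto simp: is_generator_def)
  moreover have "app \<delta> (\<mu>t t [x, y]) [] = m t x y d" for t
  proof -
    have "app \<delta> (\<mu>t t [x, y]) [] = fapp (\<lambda>_. 1) (app \<delta> (\<mu>t t [x, y]))"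
      by (subst fapp_scalar) (auto intro!: tens_app[OF _ counit] lmap_tens[OF mut])
    then show ?thesis
      by (simp add: fapp_lmap_app[OF _ counit] lmap_tens[OF mut] letters)
  qed
  moreover have "tensm 1 0 \<delta> \<delta> [x, y] [] = d x * d y"
    by (simp add: tensm_def tvm_def)
  ultimately show ?thesis by simp
qed

end

subsection \<open>The Schoenberg correspondence\<close>

context star_bialgebra_functional
begin

section \<open>The coalgebra B and its product with its conjugate\<close>

abbreviation "\<Psi> x \<equiv> \<psi> [x]"

text \<open>The coproduct of the complex conjugate coalgebra: the same basis with conjugated
  structure constants.\<close>

definition "Dbar x h = fapp2 h (conj_vec (\<Delta> [x]))"

lemma Dbar_eq: "Dbar x h = cnj (D x (\<lambda>y z. cnj (h y z)))"
  by (simp add: Dbar_def D_def fapp_conj_vec)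

lemmas functional_defs = D_def B_def S_def U_def m_def Dbar_def

lemma scale:
  "D x (\<lambda>y z. a * h y z) = a * D x h" "D x (\<lambda>y z. h y z * a) = D x h * a"
  "B x' y' (\<lambda>y z. a * h y z) = a * B x' y' h" "B x' y' (\<lambda>y z. h y z * a) = B x' y' h * a"
  "S x (\<lambda>y. a * k y) = a * S x k" "S x (\<lambda>y. k y * a) = S x k * a"
  "m t x' y' (\<lambda>y. a * k y) = a * m t x' y' k" "m t x' y' (\<lambda>y. k y * a) = m t x' y' k * a"
  "U (\<lambda>y. a * k y) = a * U k" "U (\<lambda>y. k y * a) = U k * a"
  unfolding functional_defs by (rule fapp_mult_left fapp_mult_right)+

sublocale C: coalgebra "\<lambda>x. supp (\<Delta> [x])" "\<lambda>x w. \<Delta> [x] w" "\<lambda>w. w ! 0" "\<lambda>w. w ! 1"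
  "\<lambda>f g x. D x (\<lambda>y z. f y * g z)" d
proof
  show "finite (supp (\<Delta> [x]))" for x
    using lmap_tens[OF Delta, of "[x]"] by (simp add: tens_def)
  show "D x (\<lambda>y z. f y * g z) = (\<Sum>w\<in>supp (\<Delta> [x]). \<Delta> [x] w * (f (w ! 0) * g (w ! 1)))" for f g x
    by (simp add: D_def fapp_def)
  show "D x (\<lambda>y z. D y (\<lambda>p q. f p * g q) * h z) = D x (\<lambda>y z. f y * D z (\<lambda>p q. g p * h q))" for f g h x
  proof -
    have "D y (\<lambda>p q. f p * g q * h z) = D y (\<lambda>p q. f p * g q) * h z"
      and "D z (\<lambda>p q. f y * g p * h q) = f y * D z (\<lambda>p q. g p * h q)" for y z
      by (simp_all only: mult.assoc scale(1)) (simp only: mult.assoc[symmetric] scale(2))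
    then show ?thesis using coassoc[of x "\<lambda>p q z. f p * g q * h z"] by simp
  qed
qed (rule counit_l counit_r)+

text \<open>The tensor product of the complex conjugate of the coalgebra with itself: its functionals are
  the forms \<open>(b, c) \<mapsto> A (b* \<otimes> c)\<close>, antilinear in the first argument.\<close>

sublocale P: coalgebra "\<lambda>(x, y). supp (\<Delta> [x]) \<times> supp (\<Delta> [y])" "\<lambda>(x, y) (v, w). cnj (\<Delta> [x] v) * \<Delta> [y] w"
  "\<lambda>(v, w). (v ! 0, w ! 0)" "\<lambda>(v, w). (v ! 1, w ! 1)"
  "\<lambda>f g (x, y). Dbar x (\<lambda>x1 x2. D y (\<lambda>y1 y2. f (x1, y1) * g (x2, y2)))" "\<lambda>(x, y). cnj (d x) * d y"
proof (unfold_locales, goal_cases)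
  case (1 x)
  then show ?case using C.fin by (auto split: prod.splits)
next
  case (2 f g x)
  show ?case
    by (cases x) (simp add: Dbar_def D_def fapp_def sum.cartesian_product split_def
        sum_distrib_left mult_ac conj_vec_def[THEN fun_cong])
next
  case (3 f g h xy)
  obtain x y where xy: "xy = (x, y)" by (cases xy)
  have 1: "Dbar x (\<lambda>y z. Dbar y (\<lambda>p q. k p q z)) = Dbar x (\<lambda>y z. Dbar z (\<lambda>p q. k y p q))" for k
    using coassoc[of x "\<lambda>p q z. cnj (k p q z)"] by (simp add: Dbar_eq)
  have "Dbar x (\<lambda>x1 x2. D y (\<lambda>y1 y2. Dbar x1 (\<lambda>p q. D y1 (\<lambda>p' q'. f (p, p') * g (q, q'))) * h (x2, y2)))
    = Dbar x (\<lambda>x1 x2. D y (\<lambda>y1 y2. Dbar x1 (\<lambda>p q. D y1 (\<lambda>p' q'. f (p, p') * g (q, q') * h (x2, y2)))))"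
    unfolding functional_defs by (simp only: fapp_mult_right)
  \<comment> \<open>The two coproducts from \<open>x\<close>, and likewise those from
    \<open>y\<close>, become adjacent, so coassociativity applies in each factor; afterwards the
    exchange is undone.\<close>
  also have "\<dots> = Dbar x (\<lambda>x1 x2. Dbar x1 (\<lambda>p q. D y (\<lambda>y1 y2. D y1 (\<lambda>p' q'. f (p, p') * g (q, q') * h (x2, y2)))))"
    unfolding functional_defs by (subst fapp_swap) (rule refl)
  also have "\<dots> = Dbar x (\<lambda>x1 x2. Dbar x2 (\<lambda>p q. D y (\<lambda>y1 y2. D y2 (\<lambda>p' q'. f (x1, y1) * g (p, p') * h (q, q')))))"
    by (simp only: coassoc[of y] 1)
  also have "\<dots> = Dbar x (\<lambda>x1 x2. D y (\<lambda>y1 y2. Dbar x2 (\<lambda>p q. D y2 (\<lambda>p' q'. f (x1, y1) * (g (p, p') * h (q, q'))))))"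
    unfolding functional_defs by (subst fapp_swap) (simp only: mult.assoc)
  also have "\<dots> = Dbar x (\<lambda>x1 x2. D y (\<lambda>y1 y2. f (x1, y1) * Dbar x2 (\<lambda>p q. D y2 (\<lambda>p' q'. g (p, p') * h (q, q')))))"
    unfolding functional_defs by (simp only: fapp_mult_left)
  finally show ?case by (simp add: xy)
next
  case (4 f xy)
  have "Dbar x (\<lambda>x1 x2. cnj (d x1) * k x2) = k x" for x k
    using counit_l[of x "\<lambda>x. cnj (k x)"] by (simp add: Dbar_eq)
  then show ?case by (cases xy) (simp add: mult.assoc scale counit_l)
next
  case (5 f xy)
  have "Dbar x (\<lambda>x1 x2. k x1 * cnj (d x2)) = k x" for x k
    using counit_r[of x "\<lambda>x. cnj (k x)"] by (simp add: Dbar_eq)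
  moreover have "D y (\<lambda>y1 y2. f (x1, y1) * (cnj (d x2) * d y2)) = f (x1, y) * cnj (d x2)" for y x1 x2
    using counit_r[of y "\<lambda>y. f (x1, y) * cnj (d x2)"] by (simp add: mult.assoc)
  ultimately show ?case by (cases xy) simp
qed

section \<open>The convolution semigroup generated by \<psi>\<close>

definition \<phi> :: "real \<Rightarrow> 'i \<Rightarrow> complex" where
  "\<phi> t = C.cvexp \<Psi> (of_real t)"

lemma cpow_letter: "cpow \<Delta> \<delta> \<psi> n [x] = C.pow \<Psi> n x"
  by (induction n arbitrary: x) (simp_all add: mfun_def conv_def letters)

lemma cexp_letter: "cexp \<Delta> \<delta> t \<psi> [x] = \<phi> t x"
  by (simp add: cexp_def \<phi>_def C.cvexp_def cpow_letter)

lemma \<phi>_0: "\<phi> 0 = d"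
  by (auto simp: \<phi>_def C.cvexp_0)

lemma \<phi>_add: "\<phi> (t + r) x = D x (\<lambda>y z. \<phi> t y * \<phi> r z)"
  by (simp add: \<phi>_def C.cvexp_add)

lemma \<phi>_quotient: "((\<lambda>t. (\<phi> t x - d x) / of_real t) \<longlongrightarrow> \<Psi> x) (at 0)"
proof -
  have "((\<lambda>a. (C.cvexp \<Psi> a x - d x) / a) \<longlongrightarrow> \<Psi> x) (at 0)"
    using C.cvexp_deriv[of \<Psi> x] by (simp add: has_field_derivative_iff C.cvexp_0)
  moreover have "filterlim complex_of_real (at 0) (at 0)"
    by (rule filterlim_atI) (auto intro!: tendsto_eq_intros simp: eventually_at_filter)
  ultimately show ?thesis
    unfolding \<phi>_def by (rule filterlim_compose)
qed

text \<open>The braiding passes through the coproduct by \<open>beta_Delta\<close>, after which the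
  invariant factors are removed one at a time.\<close>

lemma beta_pow: "B a b (\<lambda>p q. C.pow \<Psi> n p * h q) = C.pow \<Psi> n b * h a"
proof (induction n arbitrary: a b h)
  case (Suc n)
  have "B a b (\<lambda>p q. C.pow \<Psi> (Suc n) p * h q) = B a b (\<lambda>p q. D p (\<lambda>x y. \<Psi> x * C.pow \<Psi> n y * h q))"
    by (simp add: scale)
  also have "\<dots> = D b (\<lambda>x y. B a x (\<lambda>p q. B q y (\<lambda>p' q'. \<Psi> p * (C.pow \<Psi> n p' * h q'))))"
    by (simp add: beta_Delta mult.assoc)
  also have "\<dots> = D b (\<lambda>x y. \<Psi> x * (C.pow \<Psi> n y * h a))"
    by (simp add: scale Suc beta_psi)
  finally show ?case by (simp add: scale mult.assoc[symmetric])
qed (simp add: beta_counit)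

lemma beta_\<phi>: "B a b (\<lambda>p q. \<phi> t p * h q) = \<phi> t b * h a"
proof -
  let ?c = "\<lambda>n. complex_of_real t ^ n / of_nat (fact n)"
  have "(\<lambda>n. B a b (\<lambda>p q. ?c n * C.pow \<Psi> n p * h q)) sums B a b (\<lambda>p q. \<phi> t p * h q)"
    unfolding B_def \<phi>_def by (intro fapp_sums sums_mult2 C.cvexp_sums)
  moreover have "B a b (\<lambda>p q. ?c n * C.pow \<Psi> n p * h q) = ?c n * C.pow \<Psi> n b * h a" for n
    by (simp only: mult.assoc scale beta_pow)
  moreover have "(\<lambda>n. ?c n * C.pow \<Psi> n b * h a) sums (\<phi> t b * h a)"
    unfolding \<phi>_def by (intro sums_mult2 C.cvexp_sums)
  ultimately show ?thesis using sums_unique2 by simp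
qed

text \<open>The unit is group-like and \<psi> vanishes on it, so every positive power vanishes there
  and only the counit term contributes.\<close>

lemma \<phi>_unit: "U (\<phi> t) = 1"
proof -
  let ?c = "\<lambda>n. complex_of_real t ^ n / of_nat (fact n)"
  have "(\<lambda>n. U (\<lambda>p. ?c n * C.pow \<Psi> n p)) sums U (\<phi> t)"
    unfolding U_def \<phi>_def by (intro fapp_sums C.cvexp_sums)
  moreover have "U (\<lambda>p. ?c n * C.pow \<Psi> n p) = (if n = 0 then 1 else 0)" for n
  proof -
    have "U (C.pow \<Psi> n) = (if n = 0 then 1 else 0)"
      by (cases n) (simp_all add: scale counit_unit Delta_unit psi_unit)
    then show ?thesis by (simp only: scale) simp
  qed
  ultimately show ?thesis using sums_single[of 0 "\<lambda>_. 1 :: complex"] sums_unique2 by simp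
qed

section \<open>The semigroup of forms and its derivative\<close>

definition \<Phi> :: "real \<Rightarrow> 'i \<Rightarrow> 'i \<Rightarrow> complex" where
  "\<Phi> t x y = m t x y (\<phi> t)"

definition F :: "real \<Rightarrow> 'i \<times> 'i \<Rightarrow> complex" where
  "F t = (\<lambda>(x, y). S x (\<lambda>p. \<Phi> t p y))"

definition K :: "'i \<times> 'i \<Rightarrow> complex" where
  "K = (\<lambda>(x, y). S x (\<lambda>p. m 0 p y \<Psi> + L [p, y]))"

lemma beta_\<Phi>: "B a b (\<lambda>p1 p2. B p2 c (\<lambda>u v. \<Phi> t p1 u * h v)) = \<Phi> t b c * h a"
  using beta_mut[of a b c t "\<lambda>w v. \<phi> t w * h v"] by (simp add: scale beta_\<phi> \<Phi>_def)

text \<open>Invariance of \<open>\<phi>\<^sub>t \<circ> \<mu>\<^sub>t\<close> cancels both braidings, the one in \<open>\<Lambda>\<close> and the one in \<open>\<Delta> \<circ> *\<close>.\<close>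

lemma F_add: "F (t + r) xy = (case xy of (x, y) \<Rightarrow>
    Dbar x (\<lambda>x1 x2. D y (\<lambda>y1 y2. F t (x1, y1) * F r (x2, y2))))"
proof (cases xy)
  case (Pair x y)
  have "\<Phi> (t + r) p y = D p (\<lambda>p1 p2. D y (\<lambda>y1 y2. B p2 y1 (\<lambda>u v. \<Phi> t p1 u * \<Phi> r v y2)))" for p
    unfolding \<Phi>_def \<phi>_add Delta_mut by (simp add: scale)
  then have "F (t + r) (x, y) = S x (\<lambda>p. D p (\<lambda>p1 p2. D y (\<lambda>y1 y2. B p2 y1 (\<lambda>u v. \<Phi> t p1 u * \<Phi> r v y2))))"
    by (simp add: F_def)
  also have "\<dots> = Dbar x (\<lambda>x1 x2. S x2 (\<lambda>q2. S x1 (\<lambda>q1. B q2 q1 (\<lambda>p1 p2.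
      D y (\<lambda>y1 y2. B p2 y1 (\<lambda>u v. \<Phi> t p1 u * \<Phi> r v y2))))))"
    unfolding star_Delta Dbar_eq ..
  also have "\<dots> = Dbar x (\<lambda>x1 x2. S x2 (\<lambda>q2. S x1 (\<lambda>q1. D y (\<lambda>y1 y2. B q2 q1 (\<lambda>p1 p2.
      B p2 y1 (\<lambda>u v. \<Phi> t p1 u * \<Phi> r v y2))))))"
    unfolding functional_defs by (subst (2) fapp_swap) (rule refl)
  \<comment> \<open>Here \<open>q2\<close> passes first \<open>q1\<close> and then
    \<open>y1\<close>, hence the whole product on which \<open>\<Phi> t\<close> is
    evaluated.\<close>
  also have "\<dots> = Dbar x (\<lambda>x1 x2. S x2 (\<lambda>q2. S x1 (\<lambda>q1. D y (\<lambda>y1 y2. \<Phi> t q1 y1 * \<Phi> r q2 y2))))"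
    by (simp only: beta_\<Phi>)
  also have "\<dots> = Dbar x (\<lambda>x1 x2. D y (\<lambda>y1 y2. S x2 (\<lambda>q2. S x1 (\<lambda>q1. \<Phi> t q1 y1 * \<Phi> r q2 y2))))"
  proof -
    have "S x2 (\<lambda>q2. S x1 (\<lambda>q1. D y (\<lambda>y1 y2. \<Phi> t q1 y1 * \<Phi> r q2 y2)))
      = S x2 (\<lambda>q2. D y (\<lambda>y1 y2. S x1 (\<lambda>q1. \<Phi> t q1 y1 * \<Phi> r q2 y2)))" for x1 x2
      unfolding functional_defs by (rule arg_cong[where f = "\<lambda>g. fapp g _"], rule ext, rule fapp_swap)
    also have "S x2 (\<lambda>q2. D y (\<lambda>y1 y2. S x1 (\<lambda>q1. \<Phi> t q1 y1 * \<Phi> r q2 y2)))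
      = D y (\<lambda>y1 y2. S x2 (\<lambda>q2. S x1 (\<lambda>q1. \<Phi> t q1 y1 * \<Phi> r q2 y2)))" for x1 x2
      unfolding functional_defs by (rule fapp_swap)
    finally show ?thesis by simp
  qed
  finally show ?thesis by (simp add: Pair scale F_def)
qed

lemma F_0: "F 0 = (\<lambda>(x, y). cnj (d x) * d y)"
  by (simp add: F_def \<Phi>_def \<phi>_0 counit_mu scale star_counit)

text \<open>Applying \<open>id \<otimes> \<delta>\<close> to \<open>\<Delta> \<circ> \<mu>\<^sub>t =
  (\<mu> \<otimes> \<mu>\<^sub>t) \<circ> \<Lambda>\<close> moves the dependence on \<open>t\<close>
  into the functional \<open>\<delta> \<circ> \<mu>\<^sub>t\<close>, whose derivative is
  \<open>L\<close>.\<close>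

lemma mut_factor:
  "m t p y h = D p (\<lambda>p1 p2. D y (\<lambda>y1 y2. B p2 y1 (\<lambda>u v. m 0 p1 u h * m t v y2 d)))"
  using Delta_mut[of 0 t p y "\<lambda>a b. h a * d b"] by (simp add: counit_r scale)

text \<open>The product rule under \<open>mut_factor\<close> gives two terms. The one with
  \<open>\<Psi>\<close> collapses by \<open>mut_factor\<close> at \<open>t = 0\<close>, the one with
  \<open>L\<close> by invariance of the counit.\<close>

lemma \<Phi>_quotient: "((\<lambda>t. (\<Phi> t p y - d p * d y) / of_real t) \<longlongrightarrow> m 0 p y \<Psi> + L [p, y]) (at 0)"
proof -
  have lim: "((\<lambda>t. (m 0 p1 u (\<phi> t) * m t v y2 d - m 0 p1 u d * m 0 v y2 d) / of_real t)
      \<longlongrightarrow> m 0 p1 u \<Psi> * m 0 v y2 d + m 0 p1 u d * L [v, y2]) (at 0)" for p1 u v y2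
  proof (rule tendsto_product_quotient)
    have "((\<lambda>t. m 0 p1 u (\<lambda>z. (\<phi> t z - d z) / of_real t)) \<longlongrightarrow> m 0 p1 u \<Psi>) (at 0)"
      unfolding m_def by (intro fapp_tendsto \<phi>_quotient)
    then show "((\<lambda>t. (m 0 p1 u (\<phi> t) - m 0 p1 u d) / of_real t) \<longlongrightarrow> m 0 p1 u \<Psi>) (at 0)"
      by (simp add: m_def fapp_diff fapp_divide)
    show "((\<lambda>t. (m t v y2 d - m 0 v y2 d) / of_real t) \<longlongrightarrow> L [v, y2]) (at 0)"
      using generator[of v y2] by (simp add: counit_mu)
  qed
  have "((\<lambda>t. D p (\<lambda>p1 p2. D y (\<lambda>y1 y2. B p2 y1 (\<lambda>u v.
      (m 0 p1 u (\<phi> t) * m t v y2 d - m 0 p1 u d * m 0 v y2 d) / of_real t))))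
     \<longlongrightarrow> D p (\<lambda>p1 p2. D y (\<lambda>y1 y2. B p2 y1 (\<lambda>u v. m 0 p1 u \<Psi> * m 0 v y2 d + m 0 p1 u d * L [v, y2])))) (at 0)"
    unfolding D_def B_def by (intro fapp_tendsto lim)
  moreover have "D p (\<lambda>p1 p2. D y (\<lambda>y1 y2. B p2 y1 (\<lambda>u v.
      (m 0 p1 u (\<phi> t) * m t v y2 d - m 0 p1 u d * m 0 v y2 d) / of_real t)))
    = (\<Phi> t p y - d p * d y) / of_real t" for t
    unfolding \<Phi>_def counit_mu[of p y, symmetric] mut_factor[of _ p y]
    by (simp add: D_def B_def fapp_diff fapp_divide)
  moreover have "D p (\<lambda>p1 p2. D y (\<lambda>y1 y2. B p2 y1 (\<lambda>u v. m 0 p1 u \<Psi> * m 0 v y2 d + m 0 p1 u d * L [v, y2])))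
    = m 0 p y \<Psi> + L [p, y]"
  proof -
    have "D p (\<lambda>p1 p2. D y (\<lambda>y1 y2. B p2 y1 (\<lambda>u v. m 0 p1 u d * L [v, y2]))) = L [p, y]"
      by (simp add: counit_mu mult.assoc scale beta_counit counit_l)
    then show ?thesis unfolding mut_factor[of 0 p y \<Psi>]
      by (simp add: D_def B_def fapp_add)
  qed
  ultimately show ?thesis by simp
qed

lemma F_quotient: "((\<lambda>t. (F t (x, y) - cnj (d x) * d y) / of_real t) \<longlongrightarrow> K (x, y)) (at 0)"
proof -
  have "((\<lambda>t. S x (\<lambda>p. (\<Phi> t p y - d p * d y) / of_real t)) \<longlongrightarrow> K (x, y)) (at 0)"
    unfolding S_def K_def case_prod_conv by (intro fapp_tendsto \<Phi>_quotient)
  moreover have "S x (\<lambda>p. (\<Phi> t p y - d p * d y) / of_real t) = (F t (x, y) - cnj (d x) * d y) / of_real t" for t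
    unfolding star_counit[symmetric] F_def case_prod_conv
    by (simp add: S_def fapp_diff fapp_divide fapp_mult_right)
  ultimately show ?thesis by simp
qed

text \<open>All the products share the same unit, so the difference quotients defining
  \<open>L\<close> are zero there.\<close>

lemma L_unit: "U (\<lambda>a. L [a, y]) = 0" "U (\<lambda>a. L [y, a]) = 0"
proof -
  have 1: "((\<lambda>t. U (\<lambda>a. (m t a y d - d a * d y) / of_real t)) \<longlongrightarrow> U (\<lambda>a. L [a, y])) (at 0)"
    and 2: "((\<lambda>t. U (\<lambda>a. (m t y a d - d y * d a) / of_real t)) \<longlongrightarrow> U (\<lambda>a. L [y, a])) (at 0)"
    unfolding U_def by (intro fapp_tendsto generator)+
  have "U (\<lambda>a. (m t a y d - d a * d y) / of_real t) = (U (\<lambda>a. m t a y d) - U d * d y) / of_real t"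
    and "U (\<lambda>a. (m t y a d - d y * d a) / of_real t) = (U (\<lambda>a. m t y a d) - d y * U d) / of_real t" for t
    by (simp_all add: U_def fapp_diff fapp_divide fapp_mult_left fapp_mult_right)
  then have "((\<lambda>t::real. 0) \<longlongrightarrow> U (\<lambda>a. L [a, y])) (at 0)" "((\<lambda>t::real. 0) \<longlongrightarrow> U (\<lambda>a. L [y, a])) (at 0)"
    using 1 2 by (simp_all add: unit_mut_l unit_mut_r counit_unit)
  then show "U (\<lambda>a. L [a, y]) = 0" "U (\<lambda>a. L [y, a]) = 0"
    by (simp_all add: tendsto_const_iff)
qed

text \<open>\<open>L\<close> vanishes at the unit and \<psi> is hermitian.\<close>

lemma K_unit_r: "U (\<lambda>y. K (x, y)) = cnj (\<Psi> x)"
proof -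
  have "U (\<lambda>y. K (x, y)) = S x (\<lambda>p. U (\<lambda>y. m 0 p y \<Psi>) + U (\<lambda>y. L [p, y]))"
    unfolding K_def case_prod_conv U_def S_def by (subst fapp_swap) (simp only: fapp_add)
  then show ?thesis by (simp add: unit_mut_r L_unit star_psi)
qed

text \<open>The conjugations express antilinearity in the first slot; \<open>star_unit\<close>
  removes them because the unit is self-adjoint.\<close>

lemma K_unit_l: "cnj (U (\<lambda>x. cnj (K (x, y)))) = \<Psi> y"
proof -
  have "cnj (U (\<lambda>x. cnj (K (x, y)))) = U (\<lambda>p. m 0 p y \<Psi>) + U (\<lambda>p. L [p, y])"
    unfolding K_def case_prod_conv star_unit by (simp add: U_def fapp_add)
  then show ?thesis by (simp add: unit_mut_l L_unit)
qed

text \<open>Since \<psi>(1) = 0, the form vanishes at (1, 1) and \<psi> agrees on \<open>b\<close>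
  and \<open>b0\<close>; the unit lemmas for \<open>K\<close> supply the cross terms.\<close>

lemma K_split:
  assumes "tens 1 b"
  defines "b0 \<equiv> (\<lambda>k. b k - fapp1 d b * u [] k)"
  shows "sesq K b = sesq K b0 + fapp1 d b * cnj (fapp1 \<Psi> b) + cnj (fapp1 d b) * fapp1 \<Psi> b"
    and "tens 1 b0" and "fapp1 d b0 = 0"
proof -
  let ?a = "fapp1 d b"
  have u: "tens 1 (u [])" by (simp add: lmap_tens[OF unit])
  have fin: "finite (supp b)" "finite (supp (u []))" using assms(1) u by (auto simp: tens_def)
  have b0: "fapp g b0 = fapp g b - ?a * fapp g (u [])" for g
    unfolding b0_def by (rule fapp_diff_vec[OF fin])
  have cb0: "fapp g (conj_vec b0) = fapp g (conj_vec b) - cnj ?a * fapp g (conj_vec (u []))" for g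
    by (simp add: fapp_conj_vec b0)
  have \<psi>: "fapp1 \<Psi> b0 = fapp1 \<Psi> b"
    using psi_unit by (simp add: b0 U_def)
  show "fapp1 d b0 = 0"
    using counit_unit by (simp add: b0 U_def)
  show "tens 1 b0"
  proof -
    have "supp b0 \<subseteq> supp b \<union> supp (u [])" by (auto simp: supp_def b0_def)
    then show ?thesis using assms(1) u by (auto simp: tens_def intro: finite_subset)
  qed
  have r: "fapp1 (\<lambda>y. K (x, y)) b0 = fapp1 (\<lambda>y. K (x, y)) b - ?a * cnj (\<Psi> x)" for x
    using K_unit_r[of x] by (simp add: b0 U_def)
  have l: "fapp1 (\<lambda>x. fapp1 (\<lambda>y. K (x, y)) b) (conj_vec (u [])) = fapp1 \<Psi> b"
    using K_unit_l by (subst fapp_swap) (simp add: fapp_conj_vec U_def)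
  have c: "fapp1 (\<lambda>x. cnj (\<Psi> x)) (conj_vec b0) = cnj (fapp1 \<Psi> b)"
    by (simp add: fapp_conj_vec \<psi>)
  have "sesq K b0 = fapp1 (\<lambda>x. fapp1 (\<lambda>y. K (x, y)) b) (conj_vec b0) - ?a * cnj (fapp1 \<Psi> b)"
    unfolding sesq_def r by (simp add: fapp_diff fapp_mult_left c)
  also have "fapp1 (\<lambda>x. fapp1 (\<lambda>y. K (x, y)) b) (conj_vec b0) = sesq K b - cnj ?a * fapp1 \<Psi> b"
    unfolding cb0 l by (simp add: sesq_def)
  finally show "sesq K b = sesq K b0 + ?a * cnj (fapp1 \<Psi> b) + cnj ?a * fapp1 \<Psi> b" by simp
qed

section \<open>Positivity of the approximating forms\<close>

text \<open>The form \<open>G r\<close> differs from \<open>\<delta> \<otimes> \<delta> + r K\<close> by \<open>O(r\<^sup>2)\<close>, the square being completed so that it becomes positive.\<close>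

definition G :: "real \<Rightarrow> 'i \<times> 'i \<Rightarrow> complex" where
  "G r = (\<lambda>(x, y). cnj (d x) * d y + of_real r * K (x, y) + of_real (r\<^sup>2) * (cnj (\<Psi> x) * \<Psi> y))"

lemma psd_G:
  assumes K: "\<And>b. tens 1 b \<Longrightarrow> fapp1 d b = 0 \<Longrightarrow> cnonneg (sesq K b)" and r: "r \<ge> 0"
  shows "psd (G r)"
proof (rule psd_if_sesq)
  fix b :: "'i vec" assume b: "tens 1 b"
  let ?b0 = "\<lambda>k. b k - fapp1 d b * u [] k"
  \<comment> \<open>The cross terms of \<open>cnj ?z * ?z\<close> are exactly \<open>r\<close> times
    those of \<open>K_split\<close>.\<close>
  let ?z = "fapp1 d b + of_real r * fapp1 \<Psi> b"
  have "sesq (G r) b = cnj (fapp1 d b) * fapp1 d b + of_real r * sesq K b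
      + of_real (r\<^sup>2) * (cnj (fapp1 \<Psi> b) * fapp1 \<Psi> b)"
    unfolding sesq_def G_def case_prod_conv
    by (simp add: fapp_add fapp_mult_left fapp_mult_right) (simp add: fapp_conj_vec)
  also have "\<dots> = cnj ?z * ?z + of_real r * sesq K ?b0"
    unfolding K_split(1)[OF b] by (simp add: algebra_simps power2_eq_square)
  also have "cnonneg \<dots>"
  proof (rule cnonneg_add[OF cnonneg_cnj_mult])
    have "cnonneg (sesq K ?b0)" by (intro K K_split[OF b])
    then show "cnonneg (of_real r * sesq K ?b0)" using r by (simp add: cnonneg_def)
  qed
  finally show "cnonneg (sesq (G r) b)" .
qed

text \<open>Expanding both coproducts gives a Schur product indexed by pairs of a basis letter and a
  term of its coproduct, with \<open>A\<close> read on the left legs and \<open>A'\<close> on the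
  right ones.\<close>

lemma psd_convolution:
  assumes "psd A" "psd A'"
  shows "psd (\<lambda>(x, y). Dbar x (\<lambda>x1 x2. D y (\<lambda>y1 y2. A (x1, y1) * A' (x2, y2))))"
  unfolding psd_def
proof (intro allI impI)
  fix R :: "'i set" and v assume R: "finite R"
  let ?I = "SIGMA x:R. supp (\<Delta> [x])"
  let ?v = "\<lambda>(x, w). v x * \<Delta> [x] w"
  let ?p = "\<lambda>(x, w). w ! 0" and ?q = "\<lambda>(x, w). w ! 1"
  have I: "finite ?I" using R C.fin by auto
  have flat: "(\<Sum>i\<in>?I. g i) = (\<Sum>x\<in>R. \<Sum>w\<in>supp (\<Delta> [x]). g (x, w))" for g :: "_ \<Rightarrow> complex"
    using R C.fin by (simp add: sum.Sigma split_def)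
  have "cnonneg (\<Sum>i\<in>?I. \<Sum>j\<in>?I. cnj (?v i) * ?v j * (A (?p i, ?p j) * A' (?q i, ?q j)))"
    by (rule schur_product[OF assms I])
  also have "(\<Sum>i\<in>?I. \<Sum>j\<in>?I. cnj (?v i) * ?v j * (A (?p i, ?p j) * A' (?q i, ?q j)))
    = (\<Sum>x\<in>R. \<Sum>w\<in>supp (\<Delta> [x]). \<Sum>y\<in>R. \<Sum>w'\<in>supp (\<Delta> [y]).
       cnj (v x * \<Delta> [x] w) * (v y * \<Delta> [y] w') * (A (w ! 0, w' ! 0) * A' (w ! 1, w' ! 1)))"
    unfolding flat by simp
  also have "\<dots> = (\<Sum>x\<in>R. \<Sum>y\<in>R. \<Sum>w\<in>supp (\<Delta> [x]). \<Sum>w'\<in>supp (\<Delta> [y]).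
       cnj (v x * \<Delta> [x] w) * (v y * \<Delta> [y] w') * (A (w ! 0, w' ! 0) * A' (w ! 1, w' ! 1)))"
    by (intro sum.cong refl sum.swap)
  also have "\<dots> = (\<Sum>x\<in>R. \<Sum>y\<in>R. cnj (v x) * v y *
      (case (x, y) of (x, y) \<Rightarrow> Dbar x (\<lambda>x1 x2. D y (\<lambda>y1 y2. A (x1, y1) * A' (x2, y2)))))"
    unfolding Dbar_def D_def fapp_def supp_conj_vec
    by (simp add: conj_vec_def[THEN fun_cong] sum_distrib_left mult_ac)
  finally show "cnonneg \<dots>" .
qed

lemma psd_pow: "psd A \<Longrightarrow> psd (P.pow A n)"
proof (induction n)
  case 0
  show ?case using psd_rank_one[of d] by simp
next
  case (Suc n)
  then show ?case using psd_convolution[of A "P.pow A n"] by simp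
qed

lemma G_quotient: "((\<lambda>t. (G t (x, y) - cnj (d x) * d y) / of_real t) \<longlongrightarrow> K (x, y)) (at_right 0)"
proof -
  have "((\<lambda>t. K (x, y) + of_real t * (cnj (\<Psi> x) * \<Psi> y)) \<longlongrightarrow> K (x, y) + of_real 0 * (cnj (\<Psi> x) * \<Psi> y)) (at_right 0)"
    by (intro tendsto_intros)
  then have "((\<lambda>t. K (x, y) + of_real t * (cnj (\<Psi> x) * \<Psi> y)) \<longlongrightarrow> K (x, y)) (at_right 0)"
    by simp
  then show ?thesis
    by (rule Lim_transform_eventually) (auto simp: eventually_at_filter G_def field_simps power2_eq_square)
qed

section \<open>The equivalence for forms\<close>

theorem schoenberg:
  "(\<forall>t\<ge>0. \<forall>b. tens 1 b \<longrightarrow> cnonneg (sesq (F t) b)) \<longleftrightarrow>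
   (\<forall>b. tens 1 b \<and> fapp1 d b = 0 \<longrightarrow> cnonneg (sesq K b))"
proof (intro iffI allI impI)
  fix b :: "'i vec"
  assume pos: "\<forall>t\<ge>0. \<forall>b. tens 1 b \<longrightarrow> cnonneg (sesq (F t) b)" and b: "tens 1 b \<and> fapp1 d b = 0"
  have F': "((\<lambda>t. (F t (x, y) - cnj (d x) * d y) / of_real t) \<longlongrightarrow> K (x, y)) (at_right 0)" for x y
    by (rule tendsto_mono[OF _ F_quotient]) (simp add: at_le)
  have lim: "((\<lambda>t. sesq (\<lambda>(x, y). (F t (x, y) - cnj (d x) * d y) / of_real t) b) \<longlongrightarrow> sesq K b) (at_right 0)"
    by (rule sesq_tendsto) (simp add: F')
  \<comment> \<open>As \<open>b\<close> lies in the kernel of \<delta>, the counit term drops out of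
    the quadratic form.\<close>
  have eq: "sesq (\<lambda>(x, y). (F t (x, y) - cnj (d x) * d y) / of_real t) b = sesq (F t) b / of_real t" for t
    using b unfolding sesq_def case_prod_conv
    by (simp add: fapp_diff fapp_divide fapp_mult_left fapp_mult_right)
  show "cnonneg (sesq K b)"
    using lim unfolding eq
  proof (rule cnonneg_limit)
    show "\<forall>\<^sub>F t in at_right 0. cnonneg (sesq (F t) b / complex_of_real t)"
      using eventually_at_right_less[of 0] by eventually_elim (use pos b in \<open>auto simp: cnonneg_def\<close>)
  qed simp
next
  fix t :: real and b :: "'i vec"
  assume K: "\<forall>b. tens 1 b \<and> fapp1 d b = 0 \<longrightarrow> cnonneg (sesq K b)" and t: "t \<ge> 0" and b: "tens 1 b"
  show "cnonneg (sesq (F t) b)"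
  \<comment> \<open>The product formula requires \<open>t > 0\<close>; at \<open>0\<close> the form
    has rank one.\<close>
  proof (cases "t = 0")
    case True
    then show ?thesis using psd_sesq[OF psd_rank_one b] by (simp add: F_0)
  next
    case False
    have G: "psd (G r)" if "r \<ge> 0" for r
      by (rule psd_G) (use K that in auto)
    have "(\<lambda>n. P.pow (G (t / real n)) n (x, y)) \<longlonglongrightarrow> F t (x, y)" for x y
    proof (rule P.product_formula[where F = F and G = G and K = K, OF F_0])
      show "((\<lambda>s. (F s xy - (case xy of (x, y) \<Rightarrow> cnj (d x) * d y)) / of_real s) \<longlongrightarrow> K xy) (at_right 0)" for xy
        by (cases xy) (auto intro!: tendsto_mono[OF _ F_quotient] simp: at_le)
      show "((\<lambda>s. (G s xy - (case xy of (x, y) \<Rightarrow> cnj (d x) * d y)) / of_real s) \<longlongrightarrow> K xy) (at_right 0)" for xy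
        by (cases xy) (simp add: G_quotient)
    qed (use False t in \<open>auto simp: F_add\<close>)
    then have "(\<lambda>n. sesq (P.pow (G (t / real n)) n) b) \<longlonglongrightarrow> sesq (F t) b"
      by (rule sesq_tendsto)
    then show ?thesis
    proof (rule cnonneg_limit)
      \<comment> \<open>This holds for every \<open>n\<close>: at \<open>n = 0\<close> the quotient
        \<open>t / real n\<close> is \<open>0\<close>, which \<open>G\<close> also admits.\<close>
      show "\<forall>\<^sub>F n in sequentially. cnonneg (sesq (P.pow (G (t / real n)) n) b)"
        using t b by (intro always_eventually allI psd_sesq psd_pow G) auto
    qed simp
  qed
qed

section \<open>From forms back to tensor words\<close>

lemma fapp_star_pair:
  assumes "tens 1 b"
  shows "fapp g (tvm 1 (aapp s b) b) = sesq (\<lambda>(x, y). S x (\<lambda>p. g [p, y])) b"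
proof -
  have sb: "tens 1 (aapp s b)"
    using assms star by (simp add: aapp_eq_app tens_app)
  \<comment> \<open>The involution conjugates the coefficients of the first copy of \<open>b\<close>
    only, which produces \<open>conj_vec b\<close>.\<close>
  have "fapp g (tvm 1 (aapp s b) b) = fapp (\<lambda>k. fapp (\<lambda>p. fapp (\<lambda>l. g (p @ l)) b) (s k)) (conj_vec b)"
    using assms star unfolding fapp_tvm[OF sb] by (simp add: aapp_eq_app fapp_lmap_app[where m = 1])
  also have "\<dots> = fapp1 (\<lambda>x. S x (\<lambda>p. fapp1 (\<lambda>y. g [p, y]) b)) (conj_vec b)"
  proof -
    have "fapp (\<lambda>l. g (p @ l)) b = fapp1 (\<lambda>y. g (p @ [y])) b" for p
      by (rule fapp_letter[OF assms])
    moreover have "tens 1 (conj_vec b)" using assms by simp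
    ultimately show ?thesis
      by (subst fapp_letter) (simp_all only: star_letters append.simps)
  qed
  also have "\<dots> = sesq (\<lambda>(x, y). S x (\<lambda>p. g [p, y])) b"
    unfolding sesq_def case_prod_conv S_def by (subst (2) fapp_swap) (rule refl)
  finally show ?thesis .
qed

lemma state_form:
  assumes "tens 1 b"
  shows "fapp (cexp \<Delta> \<delta> t \<psi>) (app (\<mu>t t) (tvm 1 (aapp s b) b)) = sesq (F t) b"
proof -
  have "tens (1 + 1) (tvm 1 (aapp s b) b)"
    using assms star by (intro tens_tvm) (simp_all add: aapp_eq_app tens_app)
  then have "fapp (cexp \<Delta> \<delta> t \<psi>) (app (\<mu>t t) (tvm 1 (aapp s b) b))
     = fapp (\<lambda>k. fapp (cexp \<Delta> \<delta> t \<psi>) (\<mu>t t k)) (tvm 1 (aapp s b) b)"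
    by (intro fapp_lmap_app[OF _ mut]) (simp add: numeral_2_eq_2)
  then show ?thesis
    unfolding fapp_star_pair[OF assms] by (simp add: mut_letters cexp_letter F_def \<Phi>_def)
qed

lemma generator_form:
  assumes "tens 1 b"
  shows "fapp (\<lambda>k. fapp \<psi> (\<mu> k)) (tvm 1 (aapp s b) b) + fapp L (tvm 1 (aapp s b) b) = sesq K b"
  unfolding fapp_add[symmetric]
  unfolding fapp_star_pair[OF assms] K_def mut_0[symmetric] mut_letters ..

end

theorem mainTheorem8:
  fixes \<beta> \<beta>i \<mu> u \<Delta> \<delta> s :: "'i lmap"
    and \<mu>t :: "real \<Rightarrow> 'i lmap"
    and L \<psi> :: "'i fnl"
  assumes bialg: "braided_star_bialg \<beta> \<beta>i \<mu> u \<Delta> \<delta> s"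
    and deform: "additive_deformation \<beta> \<mu> u \<Delta> \<delta> \<mu>t"
    and gen: "is_generator \<delta> \<mu>t L"
    and herm: "\<forall>k. length k = 1 \<longrightarrow> fapp \<psi> (s k) = cnj (\<psi> k)"
    and binv: "meq 2 (comp (tensm 1 0 (fmap \<psi>) idm) \<beta>) (tensm 1 1 idm (fmap \<psi>))"
    and unit0: "fapp \<psi> (u []) = 0"
  shows "(\<forall>t::real. t \<ge> 0 \<longrightarrow>
            fapp (cexp \<Delta> \<delta> t \<psi>) (u []) = 1
          \<and> (\<forall>b. tens 1 b \<longrightarrow>
               cnonneg (fapp (cexp \<Delta> \<delta> t \<psi>) (app (\<mu>t t) (tvm 1 (aapp s b) b)))))
     \<longleftrightarrow>
         (\<forall>b. tens 1 b \<and> fapp (mfun \<delta>) b = 0 \<longrightarrow>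
               cnonneg (fapp (\<lambda>k. fapp \<psi> (\<mu> k)) (tvm 1 (aapp s b) b)
                        + fapp L (tvm 1 (aapp s b) b)))"
proof -
  interpret star_bialgebra_functional \<beta> \<beta>i \<mu> u \<Delta> \<delta> s \<mu>t L \<psi>
    using assms by unfold_locales
  \<comment> \<open>With normalisation established for every \<open>t\<close>, condition (i) becomes
    positivity of the forms \<open>F t\<close>.\<close>
  have "fapp (cexp \<Delta> \<delta> t \<psi>) (u []) = 1" for t
    by (simp add: unit_letters cexp_letter \<phi>_unit)
  moreover have "fapp (mfun \<delta>) b = fapp1 d b" if "tens 1 b" for b
    using fapp_letter[OF that, of "mfun \<delta>"] by (simp add: mfun_def)
  ultimately show ?thesis
    using schoenberg by (simp add: state_form[simplified] generator_form[simplified] cong: conj_cong)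
qed

end
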